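(* Let $\mathbb{G}$ be a stratified Lie group of step $s$, let $\theta\in[1,\infty]$, and let $\mathbf b=\sum_{i=1}^s\sum_{\alpha=1}^{n_i}b^i_\alpha X^i_\alpha$ be a vector field such that $b^i_\alpha\in W^{1,\theta}_{\mathcal H,\mathrm{loc}}(\mathbb G)$ for all $i,\alpha$ and $[\mathbf b,V_1]_p\subseteq\mathcal H_p$ for a.e. $p\in\mathbb G$. Let $k\ge1$ be an integer, $i\in\{2,\dots,s\}$, let $(i_1,\dots,i_k)\in\{1,\dots,s\}^k$ satisfy $m:=i_1+\dots+i_k<i$, let $\alpha_j\in\{1,\dots,n_{i_j}\}$ for $j=1,\dots,k$, and let $\beta_k\in\{1,\dots,n_i\}$. Then, in the sense of weak derivatives, $$X^{i_1}_{\alpha_1}\cdots X^{i_k}_{\alpha_k}b^i_{\beta_k}=\sum_{\substack{(\beta_1,\dots,\beta_{k-1})\\ 1\le\beta_j\le n_{i-m+i_1+\dots+i_j}}}\ \sum_{\beta_0=1}^{n_{i-m}}\Big(\prod_{j=1}^k c\big(i-i_k-i_{k-1}-\dots-i_j,\ i_j\big)^{\beta_j}_{\beta_{j-1}\alpha_j}\Big)\,b^{i-m}_{\beta_0},$$ where for $k=1$ the first sum is absent.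
   Context: $\mathbb{G}$ is a connected, simply connected Lie group whose Lie algebra $\mathfrak g$ of left-invariant vector fields has a stratification $\mathfrak g=V_1\oplus\dots\oplus V_s$ with nontrivial $V_i$, $V_{i+1}=[V_1,V_i]$ for $i=1,\dots,s-1$, and $[V_1,V_s]=\{0\}$. Put $n_i=\dim V_i$ and fix a basis $X^i_1,\dots,X^i_{n_i}$ of $V_i$ for each $i$. $\mathbb G$ is identified with $\mathbb R^n$ through graded exponential coordinates; the Haar measure $dp$ is Lebesgue measure. The horizontal distribution is $\mathcal H_p=V_1(p)$. The structural constants are defined by $[X^i_\alpha,X^j_\beta]=\sum_{\gamma=1}^{n_{i+j}}c(i,j)^\gamma_{\alpha\beta}X^{i+j}_\gamma$ for $i+j\le s$. Weak derivatives are given by $\langle X^i_\alpha u,\varphi\rangle=-\int uX^i_\alpha\varphi\,dp$, $\varphi\in C_c^\infty$. $W^{1,\theta}_{\mathcal H}(\Omega)$ is the set of $u\in L^\theta(\Omega)$ with $X^1_\alpha u\in L^\theta(\Omega)$ for $\alpha=1,\dots,n_1$; $\mathrm{loc}$ denotes the local version. The condition $[\mathbf b,V_1]_p\subseteq\mathcal H_p$ for a.e. $p$ means that for every $Z\in V_1$ one has $[\mathbf b,Z]_p\in\mathcal H_p$ for a.e. $p$, where $[\mathbf b,Z]=\sum_{i,\alpha}b^i_\alpha[X^i_\alpha,Z]-\sum_{i,\alpha}(Zb^i_\alpha)X^i_\alpha$ with $Zb^i_\alpha$ the weak derivative. *)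

theory Defs
  imports "HOL-Analysis.Analysis" "HOL-Library.Function_Algebras"
begin

text \<open>Vector fields on \<open>\<real>\<^sup>n\<close> form a real vector space under pointwise operations, so that
  \<^const>\<open>subspace\<close>, \<^const>\<open>span\<close>, \<^const>\<open>independent\<close> and \<^const>\<open>dim\<close> apply to sets of vector fields.\<close>

instantiation "fun" :: (type, real_vector) real_vector
begin

definition scaleR_fun :: "real \<Rightarrow> ('a \<Rightarrow> 'b) \<Rightarrow> 'a \<Rightarrow> 'b" where
  "scaleR_fun r f = (\<lambda>x. r *\<^sub>R f x)"

instance
  by standard (simp_all add: scaleR_fun_def plus_fun_def fun_eq_iff scaleR_add_right scaleR_add_left)

end

subsection \<open>Smooth vector fields on \<open>\<real>\<^sup>n\<close>\<close>

primrec times_differentiable :: "nat \<Rightarrow> ('a::real_normed_vector \<Rightarrow> 'b::real_normed_vector) \<Rightarrow> bool" where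
  "times_differentiable 0 f \<longleftrightarrow> continuous_on UNIV f"
| "times_differentiable (Suc k) f \<longleftrightarrow>
     (\<forall>x. f differentiable (at x)) \<and>
     (\<forall>v. times_differentiable k (\<lambda>x. frechet_derivative f (at x) v))"

definition smooth :: "('a::real_normed_vector \<Rightarrow> 'b::real_normed_vector) \<Rightarrow> bool" where
  "smooth f \<longleftrightarrow> (\<forall>k. times_differentiable k f)"

type_synonym 'n vfield = "real ^ 'n \<Rightarrow> real ^ 'n"

definition vf_apply :: "('n::finite) vfield \<Rightarrow> (real ^ 'n \<Rightarrow> real) \<Rightarrow> real ^ 'n \<Rightarrow> real" where
  "vf_apply X f = (\<lambda>p. frechet_derivative f (at p) (X p))"

text \<open>The coordinate expression of the commutator \<open>XY - YX\<close> of derivations.\<close>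

definition lie_bracket :: "('n::finite) vfield \<Rightarrow> 'n vfield \<Rightarrow> 'n vfield" where
  "lie_bracket X Y =
     (\<lambda>p. frechet_derivative Y (at p) (X p) - frechet_derivative X (at p) (Y p))"

definition bracket_span :: "('n::finite) vfield set \<Rightarrow> 'n vfield set \<Rightarrow> 'n vfield set" where
  "bracket_span A B = span {lie_bracket X Y | X Y. X \<in> A \<and> Y \<in> B}"

subsection \<open>Stratified Lie groups in graded exponential coordinates\<close>

definition lie_group ::
    "(real ^ 'n::finite \<Rightarrow> real ^ 'n \<Rightarrow> real ^ 'n) \<Rightarrow> real ^ 'n \<Rightarrow> (real ^ 'n \<Rightarrow> real ^ 'n) \<Rightarrow> bool" where
  "lie_group mul e iv \<longleftrightarrow>
     group mul e iv \<and> smooth (\<lambda>(p, q). mul p q) \<and> smooth iv"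

definition left_invariant_fields ::
    "(real ^ 'n::finite \<Rightarrow> real ^ 'n \<Rightarrow> real ^ 'n) \<Rightarrow> 'n vfield set" where
  "left_invariant_fields mul =
     {X. smooth X \<and> (\<forall>p q. X (mul p q) = frechet_derivative (mul p) (at q) (X q))}"

definition direct_sum_decomp :: "'v::real_vector set \<Rightarrow> nat \<Rightarrow> (nat \<Rightarrow> 'v set) \<Rightarrow> bool" where
  "direct_sum_decomp L s V \<longleftrightarrow>
     (\<forall>i\<in>{1..s}. subspace (V i) \<and> V i \<subseteq> L) \<and>
     (\<forall>x\<in>L. \<exists>!y. (\<forall>i\<in>{1..s}. y i \<in> V i) \<and> (\<forall>i. i \<notin> {1..s} \<longrightarrow> y i = 0) \<and> x = (\<Sum>i=1..s. y i))"

definition stratification :: "('n::finite) vfield set \<Rightarrow> nat \<Rightarrow> (nat \<Rightarrow> 'n vfield set) \<Rightarrow> bool" where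
  "stratification L s V \<longleftrightarrow>
     1 \<le> s \<and> direct_sum_decomp L s V \<and>
     (\<forall>i\<in>{1..s}. V i \<noteq> {0}) \<and>
     (\<forall>i\<in>{1..<s}. V (i + 1) = bracket_span (V 1) (V i)) \<and>
     bracket_span (V 1) (V s) = {0}"

text \<open>The field \<open>X i \<alpha>\<close> is \<open>X\<^sup>i\<^sub>\<alpha>\<close>; all indices start at 1.\<close>

definition graded_basis ::
    "nat \<Rightarrow> (nat \<Rightarrow> ('n::finite) vfield set) \<Rightarrow> (nat \<Rightarrow> nat) \<Rightarrow> (nat \<Rightarrow> nat \<Rightarrow> 'n vfield) \<Rightarrow> bool" where
  "graded_basis s V n X \<longleftrightarrow>
     (\<forall>i\<in>{1..s}. n i = dim (V i) \<and> inj_on (X i) {1..n i} \<and>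
        independent (X i ` {1..n i}) \<and> span (X i ` {1..n i}) = V i)"

text \<open>\<open>q\<close> is the time-one point of an integral curve of \<open>Y\<close> issued from the identity \<open>e\<close>,
  i.e. \<open>q = exp Y\<close>.\<close>

definition is_exp :: "real ^ 'n::finite \<Rightarrow> 'n vfield \<Rightarrow> real ^ 'n \<Rightarrow> bool" where
  "is_exp e Y q \<longleftrightarrow>
     (\<exists>\<gamma>. \<gamma> 0 = e \<and> (\<forall>t. (\<gamma> has_vector_derivative Y (\<gamma> t)) (at t)) \<and> \<gamma> 1 = q)"

text \<open>\<open>coord i \<alpha>\<close> is the position in \<open>\<real>\<^sup>n\<close> of the coordinate \<open>x\<^sup>i\<^sub>\<alpha>\<close>; the condition says that the
  point \<open>x\<close> is \<open>exp (\<Sum> x\<^sup>i\<^sub>\<alpha> X\<^sup>i\<^sub>\<alpha>)\<close>.  The group being carried by \<open>\<real>\<^sup>n\<close> itself, it is connected and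
  simply connected.\<close>

definition graded_exponential_coordinates ::
    "real ^ 'n::finite \<Rightarrow> nat \<Rightarrow> (nat \<Rightarrow> nat) \<Rightarrow> (nat \<Rightarrow> nat \<Rightarrow> 'n vfield) \<Rightarrow> (nat \<Rightarrow> nat \<Rightarrow> 'n) \<Rightarrow> bool" where
  "graded_exponential_coordinates e s n X coord \<longleftrightarrow>
     bij_betw (\<lambda>(i, \<alpha>). coord i \<alpha>) (SIGMA i:{1..s}. {1..n i}) UNIV \<and>
     (\<forall>x. is_exp e (\<Sum>i=1..s. \<Sum>\<alpha>=1..n i. (x $ coord i \<alpha>) *\<^sub>R X i \<alpha>) x)"

text \<open>\<open>c i j \<gamma> \<alpha> \<beta>\<close> is \<open>c(i,j)\<close> with upper index \<open>\<gamma>\<close> and lower indices \<open>\<alpha>\<beta>\<close>.\<close>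

definition structural_constants ::
    "nat \<Rightarrow> (nat \<Rightarrow> nat) \<Rightarrow> (nat \<Rightarrow> nat \<Rightarrow> ('n::finite) vfield) \<Rightarrow>
     (nat \<Rightarrow> nat \<Rightarrow> nat \<Rightarrow> nat \<Rightarrow> nat \<Rightarrow> real) \<Rightarrow> bool" where
  "structural_constants s n X c \<longleftrightarrow>
     (\<forall>i\<ge>1. \<forall>j\<ge>1. i + j \<le> s \<longrightarrow>
        (\<forall>\<alpha>\<in>{1..n i}. \<forall>\<beta>\<in>{1..n j}.
           lie_bracket (X i \<alpha>) (X j \<beta>) = (\<Sum>\<gamma>=1..n (i + j). c i j \<gamma> \<alpha> \<beta> *\<^sub>R X (i + j) \<gamma>)))"

subsection \<open>Weak derivatives and horizontal Sobolev functions\<close>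

definition in_Lp :: "ennreal \<Rightarrow> (real ^ 'n::finite) set \<Rightarrow> (real ^ 'n \<Rightarrow> real) \<Rightarrow> bool" where
  "in_Lp \<theta> A u \<longleftrightarrow>
     u \<in> borel_measurable (lebesgue_on A) \<and>
     (if \<theta> = \<infinity> then \<exists>C. AE x in lebesgue_on A. \<bar>u x\<bar> \<le> C
      else integrable (lebesgue_on A) (\<lambda>x. \<bar>u x\<bar> powr enn2real \<theta>))"

definition in_Lp_loc :: "ennreal \<Rightarrow> (real ^ 'n::finite) set \<Rightarrow> (real ^ 'n \<Rightarrow> real) \<Rightarrow> bool" where
  "in_Lp_loc \<theta> \<Omega> u \<longleftrightarrow> (\<forall>K. compact K \<and> K \<subseteq> \<Omega> \<longrightarrow> in_Lp \<theta> K u)"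

definition test_functions :: "(real ^ 'n::finite) set \<Rightarrow> (real ^ 'n \<Rightarrow> real) set" where
  "test_functions \<Omega> =
     {\<phi>. smooth \<phi> \<and> compact (closure {x. \<phi> x \<noteq> 0}) \<and> closure {x. \<phi> x \<noteq> 0} \<subseteq> \<Omega>}"

definition regular_distribution ::
    "(real ^ 'n::finite) set \<Rightarrow> (real ^ 'n \<Rightarrow> real) \<Rightarrow> (real ^ 'n \<Rightarrow> real) \<Rightarrow> real" where
  "regular_distribution \<Omega> u \<phi> = integral\<^sup>L (lebesgue_on \<Omega>) (\<lambda>x. u x * \<phi> x)"

text \<open>There is no divergence term: left-invariant fields on a nilpotent group preserve Haar measure.\<close>

definition distribution_deriv ::
    "('n::finite) vfield \<Rightarrow> ((real ^ 'n \<Rightarrow> real) \<Rightarrow> real) \<Rightarrow> (real ^ 'n \<Rightarrow> real) \<Rightarrow> real" where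
  "distribution_deriv X T = (\<lambda>\<phi>. - T (vf_apply X \<phi>))"

text \<open>\<open>weak_derivative \<Omega> [X\<^sub>1, \<dots>, X\<^sub>k] u w\<close> means \<open>X\<^sub>1 \<cdots> X\<^sub>k u = w\<close> on \<open>\<Omega>\<close>; the field \<open>X\<^sub>k\<close> acts on
  \<open>u\<close> first.\<close>

definition weak_derivative ::
    "(real ^ 'n::finite) set \<Rightarrow> 'n vfield list \<Rightarrow> (real ^ 'n \<Rightarrow> real) \<Rightarrow> (real ^ 'n \<Rightarrow> real) \<Rightarrow> bool" where
  "weak_derivative \<Omega> Xs u w \<longleftrightarrow>
     in_Lp_loc 1 \<Omega> u \<and> in_Lp_loc 1 \<Omega> w \<and>
     (\<forall>\<phi>\<in>test_functions \<Omega>.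
        foldr distribution_deriv Xs (regular_distribution \<Omega> u) \<phi> = regular_distribution \<Omega> w \<phi>)"

text \<open>A representative of the weak derivative \<open>Zu\<close>, which is determined almost everywhere;
  meaningful only if \<open>Zu\<close> is a function.\<close>

definition weak_deriv :: "('n::finite) vfield \<Rightarrow> (real ^ 'n \<Rightarrow> real) \<Rightarrow> real ^ 'n \<Rightarrow> real" where
  "weak_deriv Z u = (SOME w. weak_derivative UNIV [Z] u w)"

definition horizontal_sobolev_loc ::
    "ennreal \<Rightarrow> (real ^ 'n::finite) set \<Rightarrow> (nat \<Rightarrow> nat) \<Rightarrow> (nat \<Rightarrow> nat \<Rightarrow> 'n vfield) \<Rightarrow>
     (real ^ 'n \<Rightarrow> real) set" where
  "horizontal_sobolev_loc \<theta> \<Omega> n X =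
     {u. in_Lp_loc \<theta> \<Omega> u \<and>
         (\<forall>\<alpha>\<in>{1..n 1}. \<exists>w. in_Lp_loc \<theta> \<Omega> w \<and> weak_derivative \<Omega> [X 1 \<alpha>] u w)}"

definition horizontal_distribution :: "(nat \<Rightarrow> ('n::finite) vfield set) \<Rightarrow> real ^ 'n \<Rightarrow> (real ^ 'n) set" where
  "horizontal_distribution V p = {Y p | Y. Y \<in> V 1}"

text \<open>The commutator \<open>[b, Z]\<close> of \<open>b = \<Sum> b\<^sup>i\<^sub>\<alpha> X\<^sup>i\<^sub>\<alpha>\<close> with a smooth field \<open>Z\<close>.\<close>

definition weak_commutator ::
    "nat \<Rightarrow> (nat \<Rightarrow> nat) \<Rightarrow> (nat \<Rightarrow> nat \<Rightarrow> ('n::finite) vfield) \<Rightarrow> (nat \<Rightarrow> nat \<Rightarrow> real ^ 'n \<Rightarrow> real) \<Rightarrow>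
     'n vfield \<Rightarrow> 'n vfield" where
  "weak_commutator s n X b Z =
     (\<lambda>p. (\<Sum>i=1..s. \<Sum>\<alpha>=1..n i. b i \<alpha> p *\<^sub>R lie_bracket (X i \<alpha>) Z p)
        - (\<Sum>i=1..s. \<Sum>\<alpha>=1..n i. weak_deriv Z (b i \<alpha>) p *\<^sub>R X i \<alpha> p))"

end

theory Submission
  imports Defs
begin

text \<open>For a test function \<open>\<phi>\<close> collect the numbers \<open>\<integral> b\<^sup>i\<^sub>\<gamma> \<phi>\<close> of layer \<open>i\<close> into the left-invariant field
  \<open>F i \<phi> = \<Sum>\<^sub>\<gamma> (\<integral> b\<^sup>i\<^sub>\<gamma> \<phi>) X\<^sup>i\<^sub>\<gamma>\<close>, an element of \<open>V i\<close>.  The proof rests on the relation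

  \<open>F i (Y \<phi>) = [Y, F (i - j) \<phi>]\<close> for \<open>Y \<in> V j\<close> and \<open>j < i\<close>,

  which says that all first weak derivatives of \<open>b\<^sup>i\<close> along \<open>V j\<close> are given by the structural constants.

  For \<open>j = 1\<close> it is the hypothesis on \<open>[b, V 1]\<close>.  Almost everywhere this commutator equals, at the point
  considered, the value of a field in \<open>V 1\<close>.  Left-invariant fields that agree at one point agree
  everywhere (\<open>left_invariant_eq_zero\<close>), so the components of the commutator in the layers \<open>i \<ge> 2\<close> vanish
  (\<open>horizontal_condition_components\<close>), and integration against \<open>\<phi>\<close> gives the relation.

  It passes from \<open>V j\<close> to \<open>V (j + 1)\<close>, which is spanned by brackets \<open>[Z, Y]\<close> with \<open>Z \<in> V 1\<close> and \<open>Y \<in> V j\<close>,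
  because both sides represent the bracket in the same way (\<open>intertwining_all_layers\<close>):

  \<open>F i ([Z, Y] \<phi>) = F i (Z (Y \<phi>)) - F i (Y (Z \<phi>)) = [Z, [Y, F \<phi>]] - [Y, [Z, F \<phi>]] = [[Z, Y], F \<phi>]\<close>,

  where \<open>F \<phi>\<close> on the right is taken in layer \<open>i - j - 1\<close>.  The first equality needs the symmetry of
  second derivatives and the last one is the Jacobi identity.  Working with \<open>F\<close> instead of the functions
  \<open>b\<^sup>i\<^sub>\<gamma>\<close> replaces the quadratic identities among structural constants by the Jacobi identity
  itself.

  Comparing coefficients in the basis of \<open>V i\<close> gives the case \<open>k = 1\<close> of the theorem
  (\<open>one_step_derivative\<close>).  Since its right-hand side is a linear combination of components of \<open>b\<close> in a
  lower layer, it can be iterated; the successive summation indices are the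
  \<open>\<beta>\<^sub>k\<^sub>-\<^sub>1, \<dots>, \<beta>\<^sub>0\<close> of the formula (\<open>iterated_derivative_expansion\<close>).\<close>

section \<open>Calculus of smooth functions\<close>

lemma times_differentiable_SucD:
  "times_differentiable (Suc k) f \<Longrightarrow> times_differentiable k f"
proof (induction k arbitrary: f)
  case 0
  then show ?case
    by (auto intro!: differentiable_imp_continuous_on simp: differentiable_on_def
        intro: differentiable_at_withinI)
next
  case (Suc k)
  then show ?case by simp
qed

lemma times_differentiable_const: "times_differentiable k (\<lambda>x. a)"
  by (induction k arbitrary: a) auto

lemma times_differentiable_add:
  "times_differentiable k f \<Longrightarrow> times_differentiable k g \<Longrightarrow> times_differentiable k (\<lambda>x. f x + g x)"
proof (induction k arbitrary: f g)
  case 0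
  then show ?case by (auto intro: continuous_intros)
next
  case (Suc k)
  have "frechet_derivative (\<lambda>x. f x + g x) (at x) =
      (\<lambda>v. frechet_derivative f (at x) v + frechet_derivative g (at x) v)" for x
    using Suc.prems
    by (intro frechet_derivative_at[symmetric] has_derivative_add)
       (auto simp: frechet_derivative_works[symmetric])
  then show ?case using Suc by auto
qed

lemma times_differentiable_bounded_linear:
  assumes "bounded_linear h"
  shows "times_differentiable k f \<Longrightarrow> times_differentiable k (\<lambda>x. h (f x))"
proof (induction k arbitrary: f)
  case 0
  then show ?case
    using assms by (auto intro: bounded_linear.continuous_on)
next
  case (Suc k)
  have *: "((\<lambda>x. h (f x)) has_derivative (\<lambda>v. h (frechet_derivative f (at x) v))) (at x)" for x
    using Suc.prems by (intro bounded_linear.has_derivative[OF assms])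
       (auto simp: frechet_derivative_works[symmetric])
  from frechet_derivative_at[OF this, symmetric]
  show ?case using Suc * by (auto simp: differentiable_def)
qed

lemma times_differentiable_scaleR:
  fixes f :: "'a::real_normed_vector \<Rightarrow> real"
  shows "times_differentiable k f \<Longrightarrow> times_differentiable k g \<Longrightarrow>
    times_differentiable k (\<lambda>x. f x *\<^sub>R g x)"
proof (induction k arbitrary: f g)
  case 0
  then show ?case by (auto intro: continuous_intros)
next
  case (Suc k)
  have *: "((\<lambda>x. f x *\<^sub>R g x) has_derivative
      (\<lambda>v. f x *\<^sub>R frechet_derivative g (at x) v + frechet_derivative f (at x) v *\<^sub>R g x)) (at x)" for x
    using Suc.prems by (intro has_derivative_scaleR)
       (auto simp: frechet_derivative_works[symmetric])
  have "times_differentiable k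
      (\<lambda>x. f x *\<^sub>R frechet_derivative g (at x) v + frechet_derivative f (at x) v *\<^sub>R g x)" for v
    using Suc.prems times_differentiable_SucD[of k f] times_differentiable_SucD[of k g]
    by (intro times_differentiable_add Suc.IH) auto
  then show ?case
    using * frechet_derivative_at[OF *, symmetric] by (auto simp: differentiable_def)
qed

lemma smooth_differentiable: "smooth f \<Longrightarrow> f differentiable (at x)"
  unfolding smooth_def by (metis times_differentiable.simps(2))

lemma smooth_has_derivative: "smooth f \<Longrightarrow> (f has_derivative frechet_derivative f (at x)) (at x)"
  using smooth_differentiable frechet_derivative_works by blast

lemma smooth_continuous_on: "smooth f \<Longrightarrow> continuous_on A f"
  unfolding smooth_def by (metis times_differentiable.simps(1) continuous_on_subset subset_UNIV)

lemma smooth_directional_derivative: "smooth f \<Longrightarrow> smooth (\<lambda>x. frechet_derivative f (at x) v)"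
  unfolding smooth_def by (metis times_differentiable.simps(2))

lemma smooth_const: "smooth (\<lambda>x. a)"
  by (simp add: smooth_def times_differentiable_const)

lemma smooth_zero: "smooth (0 :: 'a::real_normed_vector \<Rightarrow> 'b::real_normed_vector)"
  using smooth_const[of 0] by (simp add: zero_fun_def)

lemma smooth_add: "smooth f \<Longrightarrow> smooth g \<Longrightarrow> smooth (\<lambda>x. f x + g x)"
  by (simp add: smooth_def times_differentiable_add)

lemma smooth_bounded_linear: "bounded_linear h \<Longrightarrow> smooth f \<Longrightarrow> smooth (\<lambda>x. h (f x))"
  by (simp add: smooth_def times_differentiable_bounded_linear)

lemma smooth_scaleR:
  fixes f :: "'a::real_normed_vector \<Rightarrow> real"
  shows "smooth f \<Longrightarrow> smooth g \<Longrightarrow> smooth (\<lambda>x. f x *\<^sub>R g x)"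
  by (simp add: smooth_def times_differentiable_scaleR)

lemma smooth_diff: "smooth f \<Longrightarrow> smooth g \<Longrightarrow> smooth (\<lambda>x. f x - g x)"
  using smooth_add[of f "\<lambda>x. - g x"] smooth_bounded_linear[of uminus g]
  by (simp add: bounded_linear_minus bounded_linear_ident)

lemma smooth_sum:
  "(\<And>i. i \<in> A \<Longrightarrow> smooth (f i)) \<Longrightarrow> smooth (\<lambda>x. \<Sum>i\<in>A. f i x)"
  by (induction A rule: infinite_finite_induct) (auto intro: smooth_const smooth_add)

lemma smooth_ident: "smooth (\<lambda>x. x)"
  unfolding smooth_def
proof
  fix k
  show "times_differentiable k (\<lambda>x::'a. x)"
    by (cases k) (auto simp: times_differentiable_const)
qed

lemma smooth_coordinate: "smooth (\<lambda>x::real^'n::finite. x $ i)"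
  by (intro smooth_bounded_linear[OF bounded_linear_vec_nth] smooth_ident)

lemma frechet_derivative_coordinates:
  assumes "f differentiable (at p)"
  shows "frechet_derivative f (at p) v =
    (\<Sum>i\<in>UNIV. (v $ i) *\<^sub>R frechet_derivative f (at p) (axis i 1))"
proof -
  have lin: "linear (frechet_derivative f (at p))"
    using assms by (rule linear_frechet_derivative)
  have "frechet_derivative f (at p) v =
      frechet_derivative f (at p) (\<Sum>i\<in>UNIV. (v $ i) *\<^sub>R axis i 1)"
    using basis_expansion[of v] by (simp add: scalar_mult_eq_scaleR)
  then show ?thesis
    by (simp add: linear_sum[OF lin] linear_scale[OF lin])
qed

text \<open>In coordinates the derivative along \<open>Y\<close> is a finite sum of products of smooth functions.\<close>

lemma smooth_derivative_along:
  fixes f :: "real ^ 'n::finite \<Rightarrow> 'b::real_normed_vector"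
  assumes "smooth f" "smooth Y"
  shows "smooth (\<lambda>p. frechet_derivative f (at p) (Y p))"
proof -
  have "smooth (\<lambda>p. \<Sum>i\<in>UNIV. (Y p $ i) *\<^sub>R frechet_derivative f (at p) (axis i 1))"
    by (intro smooth_sum smooth_scaleR smooth_directional_derivative assms
        smooth_bounded_linear[OF bounded_linear_vec_nth])
  then show ?thesis
    by (simp add: frechet_derivative_coordinates[OF smooth_differentiable[OF assms(1)], symmetric])
qed

lemma smooth_vf_apply: "smooth X \<Longrightarrow> smooth f \<Longrightarrow> smooth (vf_apply X f)"
  unfolding vf_apply_def by (rule smooth_derivative_along)

lemma smooth_lie_bracket: "smooth X \<Longrightarrow> smooth Y \<Longrightarrow> smooth (lie_bracket X Y)"
  unfolding lie_bracket_def by (intro smooth_diff smooth_derivative_along)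

section \<open>Symmetry of second derivatives\<close>

lemma has_derivative_along_line:
  fixes f :: "'a::real_normed_vector \<Rightarrow> real"
  assumes "smooth f"
  shows "((\<lambda>t. f (a + t *\<^sub>R v)) has_real_derivative frechet_derivative f (at (a + t *\<^sub>R v)) v) (at t)"
proof -
  have "((\<lambda>t. a + t *\<^sub>R v) has_derivative (\<lambda>r. r *\<^sub>R v)) (at t)"
    by (auto intro!: derivative_eq_intros)
  from diff_chain_at[OF this smooth_has_derivative[OF assms]]
  have "((\<lambda>t. f (a + t *\<^sub>R v)) has_derivative
      (\<lambda>r. frechet_derivative f (at (a + t *\<^sub>R v)) (r *\<^sub>R v))) (at t)"
    by (simp add: o_def)
  moreover have "frechet_derivative f (at (a + t *\<^sub>R v)) (r *\<^sub>R v) =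
      r * frechet_derivative f (at (a + t *\<^sub>R v)) v" for r
    using linear_scale[OF linear_frechet_derivative[OF smooth_differentiable[OF assms]]] by simp
  ultimately show ?thesis
    by (simp add: has_field_derivative_def mult_commute_abs)
qed

text \<open>The mean value theorem is applied first in the direction \<open>u\<close>, to the increment of \<open>f\<close> along
  \<open>v\<close>, and then in the direction \<open>v\<close> to the derivative of \<open>f\<close> along \<open>u\<close>.\<close>

lemma second_difference_mean_value:
  fixes f :: "'a::real_normed_vector \<Rightarrow> real"
  assumes "smooth f" "h > 0"
  obtains a t where "0 < a" "a < h" "0 < t" "t < h"
    "f (x + h *\<^sub>R u + h *\<^sub>R v) - f (x + h *\<^sub>R u) - f (x + h *\<^sub>R v) + f x =
      h\<^sup>2 * frechet_derivative (\<lambda>y. frechet_derivative f (at y) u) (at (x + a *\<^sub>R u + t *\<^sub>R v)) v"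
proof -
  define D where "D = (\<lambda>y. frechet_derivative f (at y) u)"
  have D: "smooth D"
    unfolding D_def by (rule smooth_directional_derivative[OF assms(1)])
  define g where "g = (\<lambda>r. f ((x + h *\<^sub>R v) + r *\<^sub>R u) - f (x + r *\<^sub>R u))"
  have g': "(g has_real_derivative D ((x + h *\<^sub>R v) + r *\<^sub>R u) - D (x + r *\<^sub>R u)) (at r)" for r
    unfolding g_def D_def by (intro DERIV_diff has_derivative_along_line assms)
  obtain a where a: "0 < a" "a < h"
    "g h - g 0 = h * (D ((x + h *\<^sub>R v) + a *\<^sub>R u) - D (x + a *\<^sub>R u))"
    using MVT2[OF assms(2) g'] by auto
  have D': "((\<lambda>t. D ((x + a *\<^sub>R u) + t *\<^sub>R v)) has_real_derivative
      frechet_derivative D (at ((x + a *\<^sub>R u) + t *\<^sub>R v)) v) (at t)" for t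
    by (intro has_derivative_along_line D)
  obtain t where t: "0 < t" "t < h"
    "D ((x + a *\<^sub>R u) + h *\<^sub>R v) - D (x + a *\<^sub>R u) =
      h * frechet_derivative D (at ((x + a *\<^sub>R u) + t *\<^sub>R v)) v"
    using MVT2[OF assms(2) D'] by auto
  have "f (x + h *\<^sub>R u + h *\<^sub>R v) - f (x + h *\<^sub>R u) - f (x + h *\<^sub>R v) + f x = g h - g 0"
    by (simp add: g_def algebra_simps)
  also have "\<dots> = h\<^sup>2 * frechet_derivative D (at (x + a *\<^sub>R u + t *\<^sub>R v)) v"
    using a t by (simp add: algebra_simps power2_eq_square)
  finally show thesis
    using a t that unfolding D_def by blast
qed

text \<open>The mixed second difference divided by \<open>h\<^sup>2\<close> tends to the mixed second derivative in either
  order, and it is itself symmetric in \<open>u\<close> and \<open>v\<close>.\<close>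

lemma second_derivative_symmetric:
  fixes f :: "'a::real_normed_vector \<Rightarrow> real"
  assumes f: "smooth f"
  shows "frechet_derivative (\<lambda>y. frechet_derivative f (at y) u) (at x) v =
    frechet_derivative (\<lambda>y. frechet_derivative f (at y) v) (at x) u"
proof -
  define F where "F = (\<lambda>u v y. frechet_derivative (\<lambda>y. frechet_derivative f (at y) u) (at y) v)"
  have F: "continuous_on UNIV (F u v)" for u v
    unfolding F_def
    by (intro smooth_continuous_on smooth_directional_derivative f)
  define h :: "nat \<Rightarrow> real" where "h = (\<lambda>k. inverse (real (Suc k)))"
  have h: "h k > 0" for k by (simp add: h_def)
  have h0: "h \<longlonglongrightarrow> 0" unfolding h_def by (rule LIMSEQ_inverse_real_of_nat)
  have lim: "(\<lambda>k. (f (x + h k *\<^sub>R u + h k *\<^sub>R v) - f (x + h k *\<^sub>R u) - f (x + h k *\<^sub>R v) + f x) / (h k)\<^sup>2)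
      \<longlonglongrightarrow> F u v x" for u v
  proof -
    have "\<exists>a t. 0 < a \<and> a < h k \<and> 0 < t \<and> t < h k \<and>
      f (x + h k *\<^sub>R u + h k *\<^sub>R v) - f (x + h k *\<^sub>R u) - f (x + h k *\<^sub>R v) + f x =
      (h k)\<^sup>2 * F u v (x + a *\<^sub>R u + t *\<^sub>R v)" for k
      using second_difference_mean_value[OF f h[of k], of x u v] unfolding F_def by metis
    then obtain a t where at: "\<And>k. 0 < a k" "\<And>k. a k < h k" "\<And>k. 0 < t k" "\<And>k. t k < h k"
      "\<And>k. f (x + h k *\<^sub>R u + h k *\<^sub>R v) - f (x + h k *\<^sub>R u) - f (x + h k *\<^sub>R v) + f x =
      (h k)\<^sup>2 * F u v (x + a k *\<^sub>R u + t k *\<^sub>R v)" by metis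
    have "a \<longlonglongrightarrow> 0" "t \<longlonglongrightarrow> 0"
      by (rule tendsto_sandwich[OF _ _ tendsto_const h0]; auto simp: at less_imp_le)+
    then have "(\<lambda>k. x + a k *\<^sub>R u + t k *\<^sub>R v) \<longlonglongrightarrow> x + 0 *\<^sub>R u + 0 *\<^sub>R v"
      by (intro tendsto_intros)
    then have "(\<lambda>k. F u v (x + a k *\<^sub>R u + t k *\<^sub>R v)) \<longlonglongrightarrow> F u v x"
      using continuous_on_tendsto_compose[OF F, of _ x] by auto
    then show ?thesis
      using h by (simp add: at less_imp_neq[symmetric])
  qed
  have "F u v x = F v u x"
  proof (rule LIMSEQ_unique[OF lim])
    show "(\<lambda>k. (f (x + h k *\<^sub>R u + h k *\<^sub>R v) - f (x + h k *\<^sub>R u) - f (x + h k *\<^sub>R v) + f x) / (h k)\<^sup>2)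
      \<longlonglongrightarrow> F v u x"
      using lim[of v u] by (simp add: algebra_simps)
  qed
  then show ?thesis by (simp add: F_def)
qed

section \<open>Vector fields as derivations\<close>

lemma vf_apply_coordinate: "vf_apply X (\<lambda>x. x $ i) = (\<lambda>p. X p $ i)"
  for X :: "('n::finite) vfield"
proof -
  have "((\<lambda>x::real^'n. x $ i) has_derivative (\<lambda>v. v $ i)) (at p)" for p :: "real^'n"
    by (rule bounded_linear_imp_has_derivative[OF bounded_linear_vec_nth])
  from frechet_derivative_at[OF this] show ?thesis
    unfolding vf_apply_def by metis
qed

lemma vf_apply_diff:
  assumes "smooth f" "smooth g"
  shows "vf_apply X (\<lambda>p. f p - g p) = (\<lambda>p. vf_apply X f p - vf_apply X g p)"
proof -
  have "frechet_derivative (\<lambda>p. f p - g p) (at p) =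
      (\<lambda>v. frechet_derivative f (at p) v - frechet_derivative g (at p) v)" for p
    using assms
    by (intro frechet_derivative_at[symmetric] has_derivative_diff smooth_has_derivative)
  then show ?thesis by (simp add: vf_apply_def)
qed

lemma frechet_derivative_vf_apply:
  fixes f :: "real ^ 'n::finite \<Rightarrow> real"
  assumes "smooth f" "smooth Y"
  shows "frechet_derivative (vf_apply Y f) (at p) v =
    (\<Sum>i\<in>UNIV. (Y p $ i) * frechet_derivative (\<lambda>q. frechet_derivative f (at q) (axis i 1)) (at p) v)
    + frechet_derivative f (at p) (frechet_derivative Y (at p) v)"
proof -
  let ?D = "\<lambda>i q. frechet_derivative f (at q) (axis i 1)"
  have eq: "vf_apply Y f = (\<lambda>q. \<Sum>i\<in>UNIV. (Y q $ i) * ?D i q)"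
    unfolding vf_apply_def real_scaleR_def[symmetric]
    by (rule ext) (rule frechet_derivative_coordinates[OF smooth_differentiable[OF assms(1)]])
  have "((\<lambda>q. \<Sum>i\<in>UNIV. (Y q $ i) * ?D i q) has_derivative
      (\<lambda>v. \<Sum>i\<in>UNIV. (Y p $ i) * frechet_derivative (?D i) (at p) v
          + (frechet_derivative Y (at p) v $ i) * ?D i p)) (at p)"
    by (intro has_derivative_sum has_derivative_mult smooth_has_derivative
        smooth_directional_derivative assms bounded_linear.has_derivative[OF bounded_linear_vec_nth])
  from frechet_derivative_at[OF this, symmetric] show ?thesis
    unfolding eq
    by (simp add: sum.distrib
        frechet_derivative_coordinates[OF smooth_differentiable[OF assms(1)],
          of p "frechet_derivative Y (at p) v"])
qed

text \<open>The second-order terms of \<open>XYf\<close> and \<open>YXf\<close> agree by symmetry of the Hessian of \<open>f\<close>.\<close>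

lemma vf_apply_lie_bracket:
  fixes f :: "real ^ 'n::finite \<Rightarrow> real"
  assumes f: "smooth f" and X: "smooth X" and Y: "smooth Y"
  shows "vf_apply (lie_bracket X Y) f =
    (\<lambda>p. vf_apply X (vf_apply Y f) p - vf_apply Y (vf_apply X f) p)"
proof
  fix p
  let ?D = "\<lambda>i q. frechet_derivative f (at q) (axis i 1)"
  let ?H = "\<lambda>i j. frechet_derivative (?D i) (at p) (axis j 1)"
  have H: "frechet_derivative (?D i) (at p) v = (\<Sum>j\<in>UNIV. (v $ j) * ?H i j)" for i v
    unfolding real_scaleR_def[symmetric]
    by (rule frechet_derivative_coordinates[OF smooth_differentiable
        [OF smooth_directional_derivative[OF f]]])
  have "(\<Sum>i\<in>UNIV. (Y p $ i) * frechet_derivative (?D i) (at p) (X p)) =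
      (\<Sum>i\<in>UNIV. \<Sum>j\<in>UNIV. (Y p $ i) * (X p $ j) * ?H i j)"
    by (simp add: H[of _ "X p"] sum_distrib_left mult.assoc)
  also have "\<dots> = (\<Sum>j\<in>UNIV. \<Sum>i\<in>UNIV. (Y p $ i) * (X p $ j) * ?H j i)"
    by (subst sum.swap) (simp add: second_derivative_symmetric[OF f])
  also have "\<dots> = (\<Sum>i\<in>UNIV. (X p $ i) * frechet_derivative (?D i) (at p) (Y p))"
    by (simp add: H[of _ "Y p"] sum_distrib_left mult_ac)
  finally have sym: "(\<Sum>i\<in>UNIV. (Y p $ i) * frechet_derivative (?D i) (at p) (X p)) = \<dots>" .
  have lin: "linear (frechet_derivative f (at p))"
    by (rule linear_frechet_derivative[OF smooth_differentiable[OF f]])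
  have "vf_apply X (vf_apply Y f) p - vf_apply Y (vf_apply X f) p =
      frechet_derivative f (at p) (frechet_derivative Y (at p) (X p))
      - frechet_derivative f (at p) (frechet_derivative X (at p) (Y p))"
    unfolding vf_apply_def[of X "vf_apply Y f"] vf_apply_def[of Y "vf_apply X f"]
    by (simp add: frechet_derivative_vf_apply[OF f Y] frechet_derivative_vf_apply[OF f X] sym)
  also have "\<dots> = vf_apply (lie_bracket X Y) f p"
    by (simp add: vf_apply_def lie_bracket_def linear_diff[OF lin])
  finally show "vf_apply (lie_bracket X Y) f p =
      vf_apply X (vf_apply Y f) p - vf_apply Y (vf_apply X f) p" ..
qed

text \<open>A vector field is determined by its action on the coordinate functions, so the identity
  reduces to the one for commutators of operators.\<close>

lemma lie_bracket_Jacobi: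
  fixes X Y Z :: "('n::finite) vfield"
  assumes X: "smooth X" and Y: "smooth Y" and Z: "smooth Z"
  shows "lie_bracket (lie_bracket X Y) Z =
    lie_bracket X (lie_bracket Y Z) - lie_bracket Y (lie_bracket X Z)"
proof -
  note br = vf_apply_lie_bracket
  note sm = X Y Z smooth_vf_apply smooth_lie_bracket smooth_coordinate
  have "lie_bracket (lie_bracket X Y) Z p $ i =
      (lie_bracket X (lie_bracket Y Z) p - lie_bracket Y (lie_bracket X Z) p) $ i" for p i
  proof -
    let ?f = "\<lambda>x::real^'n. x $ i"
    have "vf_apply (lie_bracket (lie_bracket X Y) Z) ?f p =
      vf_apply (lie_bracket X (lie_bracket Y Z)) ?f p - vf_apply (lie_bracket Y (lie_bracket X Z)) ?f p"
      by (simp add: br vf_apply_diff sm)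
    then show ?thesis by (simp add: vf_apply_coordinate)
  qed
  then show ?thesis by (auto simp: fun_eq_iff vec_eq_iff)
qed

lemma lie_bracket_antisym: "lie_bracket X Y = - lie_bracket Y X"
  by (simp add: lie_bracket_def fun_eq_iff)

lemma frechet_derivative_add_field:
  assumes "smooth X" "smooth Y"
  shows "frechet_derivative (X + Y) (at p) v = frechet_derivative X (at p) v + frechet_derivative Y (at p) v"
proof -
  have "(X + Y has_derivative
      (\<lambda>v. frechet_derivative X (at p) v + frechet_derivative Y (at p) v)) (at p)"
    unfolding plus_fun_def by (intro has_derivative_add smooth_has_derivative assms)
  from frechet_derivative_at[OF this] show ?thesis by metis
qed

lemma frechet_derivative_scaleR_field:
  assumes "smooth X"
  shows "frechet_derivative (r *\<^sub>R X) (at p) v = r *\<^sub>R frechet_derivative X (at p) v"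
proof -
  have "(r *\<^sub>R X has_derivative (\<lambda>v. r *\<^sub>R frechet_derivative X (at p) v)) (at p)"
    unfolding scaleR_fun_def by (intro has_derivative_scaleR_right smooth_has_derivative assms)
  from frechet_derivative_at[OF this] show ?thesis by metis
qed

lemma smooth_field_add: "smooth X \<Longrightarrow> smooth Y \<Longrightarrow> smooth (X + Y)"
  unfolding plus_fun_def by (rule smooth_add)

lemma smooth_field_scaleR: "smooth X \<Longrightarrow> smooth (r *\<^sub>R X)"
  unfolding scaleR_fun_def by (intro smooth_scaleR smooth_const)

lemma smooth_field_sum: "(\<And>i. i \<in> A \<Longrightarrow> smooth (f i)) \<Longrightarrow> smooth (\<Sum>i\<in>A. f i)"
  by (induction A rule: infinite_finite_induct) (auto intro: smooth_zero smooth_field_add)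

lemma lie_bracket_add_left:
  assumes "smooth X" "smooth Y" "smooth Z"
  shows "lie_bracket (X + Y) Z = lie_bracket X Z + lie_bracket Y Z"
  using linear_add[OF linear_frechet_derivative[OF smooth_differentiable[OF assms(3)]]]
  by (auto simp: lie_bracket_def fun_eq_iff frechet_derivative_add_field assms)

lemma lie_bracket_scaleR_left:
  assumes "smooth X" "smooth Z"
  shows "lie_bracket (r *\<^sub>R X) Z = r *\<^sub>R lie_bracket X Z"
  using linear_scale[OF linear_frechet_derivative[OF smooth_differentiable[OF assms(2)]]]
  by (simp add: lie_bracket_def fun_eq_iff frechet_derivative_scaleR_field[OF assms(1)]
      scaleR_fun_def[of r X] scaleR_fun_def[of r "\<lambda>p. _ p - _ p"] scaleR_diff_right
      frechet_derivative_scaleR_field[OF assms(1), unfolded scaleR_fun_def])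

lemma lie_bracket_zero_left:
  assumes "smooth Z"
  shows "lie_bracket 0 Z = 0"
  using lie_bracket_scaleR_left[OF smooth_zero assms, of 0] by simp

lemma lie_bracket_add_right:
  assumes "smooth X" "smooth Y" "smooth Z"
  shows "lie_bracket Z (X + Y) = lie_bracket Z X + lie_bracket Z Y"
  using lie_bracket_add_left[OF assms] lie_bracket_antisym[of Z "X + Y"]
    lie_bracket_antisym[of Z X] lie_bracket_antisym[of Z Y] by simp

lemma lie_bracket_sum_right:
  assumes "finite A" "\<And>i. i \<in> A \<Longrightarrow> smooth (F i)" "smooth Z"
  shows "lie_bracket Z (\<Sum>i\<in>A. a i *\<^sub>R F i) = (\<Sum>i\<in>A. a i *\<^sub>R lie_bracket Z (F i))"
  using assms(1,2)
proof (induction A rule: finite_induct)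
  case empty
  have "lie_bracket Z 0 = 0"
    using lie_bracket_zero_left[OF assms(3)] lie_bracket_antisym[of Z 0] by simp
  then show ?case unfolding sum.empty .
next
  case (insert i A)
  have sc: "lie_bracket Z (a i *\<^sub>R F i) = a i *\<^sub>R lie_bracket Z (F i)"
    using insert.prems lie_bracket_scaleR_left[of "F i" Z "a i"] assms(3)
      lie_bracket_antisym[of Z "a i *\<^sub>R F i"] lie_bracket_antisym[of Z "F i"] by simp
  have "lie_bracket Z (a i *\<^sub>R F i + (\<Sum>i\<in>A. a i *\<^sub>R F i)) =
      lie_bracket Z (a i *\<^sub>R F i) + lie_bracket Z (\<Sum>i\<in>A. a i *\<^sub>R F i)"
    using insert.prems by (intro lie_bracket_add_right smooth_field_sum smooth_field_scaleR assms(3)) auto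
  then show ?case
    unfolding sum.insert[OF insert.hyps]
    using insert.IH insert.prems sc by (simp only: insertI2)
qed

section \<open>Left-invariant fields\<close>

lemma sum_fields_apply: "(\<Sum>i\<in>A. F i) p = (\<Sum>i\<in>A. F i p)"
  for F :: "'i \<Rightarrow> 'a \<Rightarrow> 'b::comm_monoid_add"
  by (induction A rule: infinite_finite_induct) auto

lemma left_translation_differentiable:
  assumes "lie_group mul e iv"
  shows "mul p differentiable (at q)"
proof -
  have "(\<lambda>(p, q). mul p q) differentiable (at (p, q))"
    using assms by (auto simp: lie_group_def intro: smooth_differentiable)
  moreover have "(\<lambda>q. (p, q)) differentiable (at q)"
    by (auto simp: differentiable_def intro!: derivative_eq_intros exI)
  ultimately have "((\<lambda>(p, q). mul p q) \<circ> (\<lambda>q. (p, q))) differentiable (at q)"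
    by (intro differentiable_chain_at) auto
  then show ?thesis by (simp add: o_def)
qed

text \<open>The value at any point \<open>r\<close> is the image of the value at \<open>p\<close> under the differential of the left
  translation by \<open>r p\<^sup>-\<^sup>1\<close>, which is linear.\<close>

lemma left_invariant_eq_zero:
  assumes G: "lie_group mul e iv" and X: "X \<in> left_invariant_fields mul" and p: "X p = 0"
  shows "X = 0"
proof -
  interpret group mul e iv using G by (simp add: lie_group_def)
  have tr: "X (mul q r) = frechet_derivative (mul q) (at r) (X r)" for q r
    using X by (simp add: left_invariant_fields_def)
  have "X (mul q p) = 0" for q
    unfolding tr p
    by (rule linear_0[OF linear_frechet_derivative[OF left_translation_differentiable[OF G]]])
  from this[of "mul r (iv p)" for r] have "X r = 0" for r
    by (simp add: assoc left_inverse)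
  then show ?thesis by (simp add: fun_eq_iff)
qed

lemma smooth_left_invariant: "X \<in> left_invariant_fields mul \<Longrightarrow> smooth X"
  by (simp add: left_invariant_fields_def)

lemma subspace_left_invariant_fields:
  assumes G: "lie_group mul e iv"
  shows "subspace (left_invariant_fields mul)"
proof -
  note lin = linear_frechet_derivative[OF left_translation_differentiable[OF G]]
  show ?thesis
    by (rule subspaceI)
       (auto simp: left_invariant_fields_def smooth_zero smooth_field_add smooth_field_scaleR
          linear_0[OF lin] linear_add[OF lin] linear_scale[OF lin] scaleR_fun_def
          intro: smooth_scaleR smooth_const)
qed

lemma graded_basis_coefficients:
  assumes B: "graded_basis s V n X" and i: "i \<in> {1..s}"
    and eq: "(\<Sum>\<gamma>=1..n i. a \<gamma> *\<^sub>R X i \<gamma>) = (\<Sum>\<gamma>=1..n i. a' \<gamma> *\<^sub>R X i \<gamma>)"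
    and g: "\<gamma> \<in> {1..n i}"
  shows "a \<gamma> = a' \<gamma>"
proof -
  let ?A = "{1..n i}"
  have inj: "inj_on (X i) ?A" and ind: "independent (X i ` ?A)"
    using B i unfolding graded_basis_def by blast+
  define u where "u = (\<lambda>v. a (the_inv_into ?A (X i) v) - a' (the_inv_into ?A (X i) v))"
  have "(\<Sum>v\<in>X i ` ?A. u v *\<^sub>R v) = (\<Sum>\<gamma>\<in>?A. (a \<gamma> - a' \<gamma>) *\<^sub>R X i \<gamma>)"
    unfolding sum.reindex[OF inj] o_def
    by (intro sum.cong refl) (simp only: u_def the_inv_into_f_f[OF inj])
  also have "\<dots> = 0"
    using eq by (simp only: scaleR_diff_left sum_subtractf diff_self)
  finally have "u (X i \<gamma>) = 0"
    using independentD[OF ind, of "X i ` ?A" u "X i \<gamma>"] g by blast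
  then show ?thesis unfolding u_def the_inv_into_f_f[OF inj g] by simp
qed

section \<open>Locally integrable functions as distributions\<close>

lemma in_Lp_loc_one_iff:
  "in_Lp_loc 1 UNIV u \<longleftrightarrow> (\<forall>K. compact K \<longrightarrow> integrable (lebesgue_on K) u)"
proof -
  have "in_Lp 1 K u \<longleftrightarrow> integrable (lebesgue_on K) u" for K
    by (auto simp: in_Lp_def integrable_abs_iff)
  then show ?thesis by (simp add: in_Lp_loc_def)
qed

lemma test_function_smooth: "\<phi> \<in> test_functions \<Omega> \<Longrightarrow> smooth \<phi>"
  by (simp add: test_functions_def)

lemma vf_apply_test_function:
  assumes "smooth X" "\<phi> \<in> test_functions UNIV"
  shows "vf_apply X \<phi> \<in> test_functions UNIV"
proof -
  let ?S = "closure {x. \<phi> x \<noteq> 0}"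
  have "vf_apply X \<phi> p = 0" if p: "p \<notin> ?S" for p
  proof -
    have "(\<phi> has_derivative (\<lambda>_. 0)) (at p)"
    proof (rule has_derivative_transform_within_open[OF has_derivative_const])
      show "open (- ?S)" by auto
      show "p \<in> - ?S" using p by simp
      show "0 = \<phi> x" if "x \<in> - ?S" for x
        using that closure_subset[of "{x. \<phi> x \<noteq> 0}"] by auto
    qed
    then show ?thesis by (simp add: vf_apply_def frechet_derivative_at[symmetric])
  qed
  then have "closure {x. vf_apply X \<phi> x \<noteq> 0} \<subseteq> ?S"
    by (intro closure_minimal) auto
  moreover have "compact ?S"
    using assms by (simp add: test_functions_def)
  ultimately have "compact (closure {x. vf_apply X \<phi> x \<noteq> 0})"
    using compact_closure bounded_subset compact_imp_bounded by (metis closure_closure)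
  then show ?thesis
    using assms by (auto simp: test_functions_def smooth_vf_apply)
qed

text \<open>A test function is bounded and vanishes off a compact set, on which \<open>u\<close> is integrable.\<close>

lemma integrable_times_test_function:
  assumes u: "in_Lp_loc 1 UNIV u" and \<phi>: "\<phi> \<in> test_functions UNIV"
  shows "integrable lebesgue (\<lambda>x. u x * \<phi> x)"
proof -
  define K where "K = closure {x. \<phi> x \<noteq> 0}"
  have K: "compact K" using \<phi> by (simp add: K_def test_functions_def)
  have out: "\<phi> x = 0" if "x \<notin> K" for x
    using that closure_subset[of "{x. \<phi> x \<noteq> 0}"] by (auto simp: K_def)
  have cont: "continuous_on UNIV \<phi>"
    using \<phi> by (intro smooth_continuous_on test_function_smooth)
  obtain M where M: "\<And>x. x \<in> K \<Longrightarrow> \<bar>\<phi> x\<bar> \<le> M"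
    using compact_imp_bounded[OF compact_continuous_image[OF continuous_on_subset[OF cont] K]]
    by (auto simp: bounded_iff)
  have "K \<in> sets lebesgue" using K by (simp add: borel_compact)
  then have uK: "integrable lebesgue (\<lambda>x. indicator K x *\<^sub>R u x)"
    using u K integrable_restrict_space[of K lebesgue u] by (auto simp: in_Lp_loc_one_iff)
  have eq: "u x * \<phi> x = (indicator K x *\<^sub>R u x) * \<phi> x" for x
    using out[of x] by (cases "x \<in> K") auto
  have meas: "\<phi> \<in> borel_measurable lebesgue"
    using continuous_imp_measurable_on_sets_lebesgue[OF cont] by (simp add: lebesgue_on_UNIV_eq)
  show ?thesis unfolding eq
  proof (rule Bochner_Integration.integrable_bound)
    show "integrable lebesgue (\<lambda>x. M * (indicator K x *\<^sub>R u x))"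
      using uK by (rule integrable_mult_right)
    show "(\<lambda>x. (indicator K x *\<^sub>R u x) * \<phi> x) \<in> borel_measurable lebesgue"
      using uK meas by (intro borel_measurable_times) auto
    have "norm ((indicator K x *\<^sub>R u x) * \<phi> x) \<le> norm (M * (indicator K x *\<^sub>R u x))" for x
    proof (cases "x \<in> K")
      case True
      have "\<bar>u x\<bar> * \<bar>\<phi> x\<bar> \<le> \<bar>u x\<bar> * \<bar>M\<bar>"
        using M[OF True] by (intro mult_left_mono) auto
      then show ?thesis using True by (simp add: abs_mult mult.commute)
    qed simp
    then show "AE x in lebesgue. norm ((indicator K x *\<^sub>R u x) * \<phi> x) \<le> norm (M * (indicator K x *\<^sub>R u x))"
      by simp
  qed
qed

lemma regular_distribution_sum:
  assumes "\<And>x. x \<in> A \<Longrightarrow> in_Lp_loc 1 UNIV (u x)" "\<phi> \<in> test_functions UNIV"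
  shows "regular_distribution UNIV (\<lambda>p. \<Sum>x\<in>A. a x * u x p) \<phi> =
    (\<Sum>x\<in>A. a x * regular_distribution UNIV (u x) \<phi>)"
proof -
  have "(\<Sum>x\<in>A. a x * integral\<^sup>L lebesgue (\<lambda>p. u x p * \<phi> p)) =
      integral\<^sup>L lebesgue (\<lambda>p. \<Sum>x\<in>A. a x * (u x p * \<phi> p))"
    using integrable_times_test_function[OF assms(1) assms(2)]
    by (subst Bochner_Integration.integral_sum) auto
  then show ?thesis
    by (simp add: regular_distribution_def lebesgue_on_UNIV_eq sum_distrib_right mult.assoc)
qed

lemma in_Lp_loc_one_sum:
  assumes "\<And>x. x \<in> A \<Longrightarrow> in_Lp_loc 1 UNIV (u x)"
  shows "in_Lp_loc 1 UNIV (\<lambda>p. \<Sum>x\<in>A. a x * u x p)"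
  using assms unfolding in_Lp_loc_one_iff by (auto intro!: integrable_sum)

lemma regular_distribution_linear_test:
  assumes "in_Lp_loc 1 UNIV u" "\<phi> \<in> test_functions UNIV" "\<psi> \<in> test_functions UNIV"
  shows "regular_distribution UNIV u (\<lambda>p. r * \<phi> p + \<psi> p) =
    r * regular_distribution UNIV u \<phi> + regular_distribution UNIV u \<psi>"
proof -
  have "regular_distribution UNIV u (\<lambda>p. r * \<phi> p + \<psi> p) =
      (\<integral>p. r * (u p * \<phi> p) + u p * \<psi> p \<partial>lebesgue)"
    by (simp add: regular_distribution_def lebesgue_on_UNIV_eq algebra_simps)
  also have "\<dots> = r * regular_distribution UNIV u \<phi> + regular_distribution UNIV u \<psi>"
    using integrable_times_test_function[OF assms(1,2)] integrable_times_test_function[OF assms(1,3)]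
    by (subst Bochner_Integration.integral_add)
       (auto simp: regular_distribution_def lebesgue_on_UNIV_eq)
  finally show ?thesis .
qed

lemma regular_distribution_cong_AE:
  assumes "in_Lp_loc 1 UNIV u" "in_Lp_loc 1 UNIV w" "\<phi> \<in> test_functions UNIV"
    "AE p in lebesgue. u p = w p"
  shows "regular_distribution UNIV u \<phi> = regular_distribution UNIV w \<phi>"
proof -
  have "AE p in lebesgue. u p * \<phi> p = w p * \<phi> p"
    using assms(4) by eventually_elim simp
  then show ?thesis
    using integrable_times_test_function[OF assms(1,3)] integrable_times_test_function[OF assms(2,3)]
    unfolding regular_distribution_def lebesgue_on_UNIV_eq
    by (intro integral_cong_AE) auto
qed

section \<open>The horizontality condition in components\<close>

lemma stratification_layer:
  assumes "stratification (left_invariant_fields mul) s V" "i \<in> {1..s}"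
  shows "subspace (V i)" "V i \<subseteq> left_invariant_fields mul"
  using assms by (auto simp: stratification_def direct_sum_decomp_def)

lemma graded_basis_in_layer:
  assumes "graded_basis s V n X" "i \<in> {1..s}" "\<gamma> \<in> {1..n i}"
  shows "X i \<gamma> \<in> V i"
  using assms span_base[of "X i \<gamma>" "X i ` {1..n i}"] unfolding graded_basis_def by blast

lemma top_layer_bracket_zero:
  assumes "stratification L s V" "Y \<in> V s" "Z \<in> V 1"
  shows "lie_bracket Y Z = 0"
proof -
  have "lie_bracket Z Y \<in> bracket_span (V 1) (V s)"
    unfolding bracket_span_def using assms(2,3) by (intro span_base) blast
  then have "lie_bracket Z Y = 0"
    using assms(1) by (simp add: stratification_def)
  then show ?thesis using lie_bracket_antisym[of Y Z] by simp
qed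

lemma direct_sum_unique:
  assumes D: "direct_sum_decomp L s V" and x: "x \<in> L"
    and y: "\<And>i. i \<in> {1..s} \<Longrightarrow> y i \<in> V i" "x = (\<Sum>i=1..s. y i)"
    and z: "\<And>i. i \<in> {1..s} \<Longrightarrow> z i \<in> V i" "x = (\<Sum>i=1..s. z i)"
    and i: "i \<in> {1..s}"
  shows "y i = z i"
proof -
  let ?e = "\<lambda>y i. if i \<in> {1..s} then y i else 0"
  have sum: "(\<Sum>i=1..s. ?e y i) = (\<Sum>i=1..s. y i)" for y :: "nat \<Rightarrow> 'a"
    by (intro sum.cong) auto
  have ex1: "\<exists>!y. (\<forall>i\<in>{1..s}. y i \<in> V i) \<and> (\<forall>i. i \<notin> {1..s} \<longrightarrow> y i = 0) \<and> x = (\<Sum>i=1..s. y i)"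
    using D x by (simp add: direct_sum_decomp_def)
  have ey: "(\<forall>i\<in>{1..s}. ?e y i \<in> V i) \<and> (\<forall>i. i \<notin> {1..s} \<longrightarrow> ?e y i = 0) \<and> x = (\<Sum>i=1..s. ?e y i)"
    unfolding sum using y by auto
  have ez: "(\<forall>i\<in>{1..s}. ?e z i \<in> V i) \<and> (\<forall>i. i \<notin> {1..s} \<longrightarrow> ?e z i = 0) \<and> x = (\<Sum>i=1..s. ?e z i)"
    unfolding sum using z by auto
  have unique: "u = v" if "\<exists>!x. P x" "P u" "P v" for P and u v :: "nat \<Rightarrow> 'a"
    using that by auto
  have "?e y = ?e z" by (rule unique[OF ex1 ey ez])
  then have "?e y i = ?e z i" by metis
  then show ?thesis using i by simp
qed

lemma sum_shift_one:
  fixes g h :: "nat \<Rightarrow> 'a::ab_group_add"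
  assumes "1 \<le> s" "g s = 0" "h 1 = 0" "\<And>i. 1 \<le> i \<Longrightarrow> i < s \<Longrightarrow> h (Suc i) = g i"
  shows "(\<Sum>i=1..s. g i) = (\<Sum>i=1..s. h i)"
proof -
  obtain t where t: "s = Suc t" using assms(1) by (cases s) auto
  have "(\<Sum>i=1..s. h i) = h 1 + (\<Sum>i=1..t. h (Suc i))"
    unfolding t by (simp add: sum.atLeast_Suc_atMost sum.atLeast_Suc_atMost_Suc_shift
        del: sum.cl_ivl_Suc)
  also have "\<dots> = (\<Sum>i=1..t. g i)"
    using assms(3,4) t by simp
  also have "\<dots> = (\<Sum>i=1..s. g i)"
    using assms(2) t by simp
  finally show ?thesis ..
qed

text \<open>Freezing the coefficients \<open>b\<^sup>i\<^sub>\<gamma>\<close> and their derivatives at their values at \<open>p\<close> turns the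
  commutator into a left-invariant field \<open>\<Sum>\<^sub>i F\<^sub>i\<close>.  It agrees at \<open>p\<close> with a field in \<open>V 1\<close>, hence
  everywhere, so that \<open>F\<^sub>i = 0\<close> for \<open>i \<ge> 2\<close>.\<close>

lemma horizontal_condition_components:
  assumes G: "lie_group mul e iv"
    and S: "stratification (left_invariant_fields mul) s V"
    and B: "graded_basis s V n X" and C: "structural_constants s n X c"
    and \<alpha>: "\<alpha> \<in> {1..n 1}" and i: "i \<in> {2..s}" and \<gamma>: "\<gamma> \<in> {1..n i}"
    and H: "weak_commutator s n X b (X 1 \<alpha>) p \<in> horizontal_distribution V p"
  shows "weak_deriv (X 1 \<alpha>) (b i \<gamma>) p = (\<Sum>\<beta>=1..n (i - 1). c (i - 1) 1 \<gamma> \<beta> \<alpha> * b (i - 1) \<beta> p)"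
proof -
  let ?L = "left_invariant_fields mul" and ?Z = "X 1 \<alpha>"
  have s: "1 \<le> s" and D: "direct_sum_decomp ?L s V"
    using S by (auto simp: stratification_def)
  \<comment> \<open>The bracket with \<open>X 1 \<alpha>\<close> raises the layer by one, so layer \<open>i\<close> of \<open>\<Sum> b [X, X 1 \<alpha>]\<close> comes from
    layer \<open>i - 1\<close> of \<open>b\<close> and layer 1 receives nothing.\<close>
  define d where "d = (\<lambda>i \<gamma>. if i = 1 then 0 else
    \<Sum>\<beta>=1..n (i - 1). c (i - 1) 1 \<gamma> \<beta> \<alpha> * b (i - 1) \<beta> p)"
  define w where "w = (\<lambda>i \<gamma>. weak_deriv ?Z (b i \<gamma>) p)"
  define F where "F = (\<lambda>i. \<Sum>\<gamma>=1..n i. (d i \<gamma> - w i \<gamma>) *\<^sub>R X i \<gamma>)"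
  have XV: "X i \<gamma> \<in> V i" if "i \<in> {1..s}" "\<gamma> \<in> {1..n i}" for i \<gamma>
    using graded_basis_in_layer[OF B] that by blast
  have FV: "F i \<in> V i" if "i \<in> {1..s}" for i
    unfolding F_def
    by (intro subspace_sum subspace_scale stratification_layer[OF S] XV that)
  have "(\<Sum>i=1..s. \<Sum>\<gamma>=1..n i. b i \<gamma> p *\<^sub>R lie_bracket (X i \<gamma>) ?Z p) =
      (\<Sum>i=1..s. \<Sum>\<gamma>=1..n i. d i \<gamma> *\<^sub>R X i \<gamma> p)"
  proof (rule sum_shift_one[OF s])
    show "(\<Sum>\<gamma>=1..n s. b s \<gamma> p *\<^sub>R lie_bracket (X s \<gamma>) ?Z p) = 0"
    proof (intro sum.neutral ballI)
      fix \<gamma> assume "\<gamma> \<in> {1..n s}"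
      then have "lie_bracket (X s \<gamma>) ?Z = 0"
        using top_layer_bracket_zero[OF S] XV s \<alpha> by auto
      then show "b s \<gamma> p *\<^sub>R lie_bracket (X s \<gamma>) ?Z p = 0" by simp
    qed
    show "(\<Sum>\<gamma>=1..n 1. d 1 \<gamma> *\<^sub>R X 1 \<gamma> p) = 0" by (simp add: d_def)
    fix i assume i: "1 \<le> i" "i < s"
    have "lie_bracket (X i \<beta>) ?Z p = (\<Sum>\<gamma>=1..n (Suc i). c i 1 \<gamma> \<beta> \<alpha> *\<^sub>R X (Suc i) \<gamma> p)"
      if "\<beta> \<in> {1..n i}" for \<beta>
    proof -
      have "i + 1 \<le> s" "(1::nat) \<le> 1" using i by auto
      then have "lie_bracket (X i \<beta>) ?Z = (\<Sum>\<gamma>=1..n (i + 1). c i 1 \<gamma> \<beta> \<alpha> *\<^sub>R X (i + 1) \<gamma>)"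
        using C i(1) that \<alpha> unfolding structural_constants_def by blast
      then show ?thesis by (simp add: sum_fields_apply scaleR_fun_def)
    qed
    then have "(\<Sum>\<beta>=1..n i. b i \<beta> p *\<^sub>R lie_bracket (X i \<beta>) ?Z p) =
        (\<Sum>\<beta>=1..n i. \<Sum>\<gamma>=1..n (Suc i). (c i 1 \<gamma> \<beta> \<alpha> * b i \<beta> p) *\<^sub>R X (Suc i) \<gamma> p)"
      by (simp add: scaleR_sum_right mult.commute)
    also have "\<dots> = (\<Sum>\<gamma>=1..n (Suc i). d (Suc i) \<gamma> *\<^sub>R X (Suc i) \<gamma> p)"
      using i by (subst sum.swap) (simp add: d_def scaleR_sum_left)
    finally show "(\<Sum>\<gamma>=1..n (Suc i). d (Suc i) \<gamma> *\<^sub>R X (Suc i) \<gamma> p) =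
        (\<Sum>\<beta>=1..n i. b i \<beta> p *\<^sub>R lie_bracket (X i \<beta>) ?Z p)" ..
  qed
  then have wc: "weak_commutator s n X b ?Z p = (\<Sum>i=1..s. F i) p"
    by (simp add: weak_commutator_def F_def w_def sum_fields_apply scaleR_fun_def
        scaleR_diff_left sum_subtractf)
  obtain Y where Y: "Y \<in> V 1" "weak_commutator s n X b ?Z p = Y p"
    using H unfolding horizontal_distribution_def by blast
  have one: "1 \<in> {1..s}" using s by simp
  have subL: "subspace ?L" by (rule subspace_left_invariant_fields[OF G])
  have YL: "Y \<in> ?L" using Y stratification_layer[OF S one] by blast
  have "(\<Sum>i=1..s. F i) \<in> ?L"
    using FV stratification_layer(2)[OF S] by (intro subspace_sum subL) blast
  then have "(\<Sum>i=1..s. F i) - Y \<in> ?L"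
    using YL by (intro subspace_diff subL)
  then have "(\<Sum>i=1..s. F i) - Y = 0"
    by (rule left_invariant_eq_zero[OF G, where p = p]) (use wc Y in simp)
  then have FY: "Y = (\<Sum>i=1..s. F i)" by simp
  have "Y = (\<Sum>i=1..s. if i = 1 then Y else 0)"
    using one by (subst sum.delta) (simp_all only: finite_atLeastAtMost if_True)
  moreover have "(if k = 1 then Y else 0) \<in> V k" if "k \<in> {1..s}" for k
    using Y(1) subspace_0[OF stratification_layer(1)[OF S that]] by simp
  ultimately have "F i = (if i = 1 then Y else 0)"
    using i by (intro direct_sum_unique[OF D YL FV FY]) simp_all
  then have "F i = 0" using i by auto
  then have "(\<Sum>\<gamma>=1..n i. d i \<gamma> *\<^sub>R X i \<gamma>) = (\<Sum>\<gamma>=1..n i. w i \<gamma> *\<^sub>R X i \<gamma>)"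
    unfolding F_def scaleR_diff_left sum_subtractf by (simp only: right_minus_eq)
  then have "d i \<gamma> = w i \<gamma>"
    using i by (intro graded_basis_coefficients[OF B _ _ \<gamma>]) auto
  then show ?thesis using i by (simp add: d_def w_def)
qed

section \<open>Equivariance along the stratification\<close>

lemma vf_apply_linear_field:
  assumes "\<phi> \<in> test_functions UNIV"
  shows "vf_apply (r *\<^sub>R X + Y) \<phi> = (\<lambda>p. r * vf_apply X \<phi> p + vf_apply Y \<phi> p)"
proof -
  note lin = linear_frechet_derivative[OF smooth_differentiable[OF test_function_smooth[OF assms]]]
  show ?thesis
    by (simp add: vf_apply_def linear_add[OF lin] linear_scale[OF lin] scaleR_fun_def)
qed

text \<open>The form \<open>r \<phi> + \<psi>\<close> is the one in which span induction presents an element of a span; \<open>r = - 1\<close> gives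
  differences, and with \<open>\<phi> = \<psi>\<close> also the zero function.\<close>

definition test_linear :: "((real ^ 'n::finite \<Rightarrow> real) \<Rightarrow> 'n vfield) \<Rightarrow> bool" where
  "test_linear B \<longleftrightarrow> (\<forall>\<phi>\<in>test_functions UNIV. \<forall>\<psi>\<in>test_functions UNIV. \<forall>r.
     B (\<lambda>p. r * \<phi> p + \<psi> p) = r *\<^sub>R B \<phi> + B \<psi>)"

text \<open>Both sides of the relation are linear in the field \<open>Y\<close>.\<close>

lemma intertwining_span:
  assumes B: "test_linear B" and W: "\<And>\<phi>. \<phi> \<in> test_functions UNIV \<Longrightarrow> smooth (W \<phi>)"
    and S: "\<And>Y. Y \<in> S \<Longrightarrow> smooth Y"
    and eq: "\<And>Y \<phi>. Y \<in> S \<Longrightarrow> \<phi> \<in> test_functions UNIV \<Longrightarrow> B (vf_apply Y \<phi>) = lie_bracket Y (W \<phi>)"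
    and Y: "Y \<in> span S" and \<phi>: "\<phi> \<in> test_functions UNIV"
  shows "B (vf_apply Y \<phi>) = lie_bracket Y (W \<phi>)"
proof -
  have "smooth Y \<and> B (vf_apply Y \<phi>) = lie_bracket Y (W \<phi>)"
    using Y
  proof (induction rule: span_induct_alt)
    case base
    have "vf_apply 0 \<phi> = (\<lambda>p. (- 1) * \<phi> p + \<phi> p)"
      using linear_0[OF linear_frechet_derivative[OF smooth_differentiable[OF test_function_smooth[OF \<phi>]]]]
      by (simp add: vf_apply_def)
    moreover have "B (\<lambda>p. (- 1) * \<phi> p + \<phi> p) = (- 1) *\<^sub>R B \<phi> + B \<phi>"
      using B \<phi> unfolding test_linear_def by blast
    ultimately have "B (vf_apply 0 \<phi>) = 0" by simp
    then show ?case
      unfolding lie_bracket_zero_left[OF W[OF \<phi>]] using smooth_zero by blast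
  next
    case (step r X Y)
    have sX: "smooth X" by (rule S[OF step(1)])
    have sY: "smooth Y" using step(2) ..
    have eY: "B (vf_apply Y \<phi>) = lie_bracket Y (W \<phi>)" using step(2) ..
    have "B (vf_apply (r *\<^sub>R X + Y) \<phi>) = r *\<^sub>R B (vf_apply X \<phi>) + B (vf_apply Y \<phi>)"
      unfolding vf_apply_linear_field[OF \<phi>]
      using B[unfolded test_linear_def, rule_format,
          OF vf_apply_test_function[OF sX \<phi>] vf_apply_test_function[OF sY \<phi>]] .
    also have "\<dots> = lie_bracket (r *\<^sub>R X + Y) (W \<phi>)"
      unfolding eY eq[OF step(1) \<phi>]
        lie_bracket_add_left[OF smooth_field_scaleR[OF sX] sY W[OF \<phi>]]
        lie_bracket_scaleR_left[OF sX W[OF \<phi>]] ..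
    finally show ?case
      using smooth_field_add[OF smooth_field_scaleR[OF sX] sY] by blast
  qed
  then show ?thesis ..
qed

text \<open>A bracket \<open>[Z, Y]\<close> acts on test functions as the commutator \<open>ZY - YZ\<close> and, by the Jacobi
  identity, on fields as the commutator of the brackets with \<open>Z\<close> and with \<open>Y\<close>.  So the relation for
  \<open>V 1\<close> and \<open>V j\<close> implies it for the brackets, which span \<open>V (j + 1)\<close>.\<close>

lemma intertwining_all_layers:
  fixes mul :: "real ^ 'n::finite \<Rightarrow> real ^ 'n \<Rightarrow> real ^ 'n"
  assumes S: "stratification (left_invariant_fields mul) s V"
    and lin: "\<And>i. i \<in> {1..s} \<Longrightarrow> test_linear (B i)"
    and smooth: "\<And>i \<phi>. i \<in> {1..s} \<Longrightarrow> \<phi> \<in> test_functions UNIV \<Longrightarrow> smooth (B i \<phi>)"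
    and base: "\<And>i Y \<phi>. i \<in> {2..s} \<Longrightarrow> Y \<in> V 1 \<Longrightarrow> \<phi> \<in> test_functions UNIV \<Longrightarrow>
      B i (vf_apply Y \<phi>) = lie_bracket Y (B (i - 1) \<phi>)"
  shows "1 \<le> j \<Longrightarrow> j < i \<Longrightarrow> i \<le> s \<Longrightarrow> Y \<in> V j \<Longrightarrow> \<phi> \<in> test_functions UNIV \<Longrightarrow>
      B i (vf_apply Y \<phi>) = lie_bracket Y (B (i - j) \<phi>)"
proof (induction j arbitrary: i Y \<phi> rule: dec_induct)
  case base
  then show ?case using assms(4) by simp
next
  case (step j)
  note \<phi> = \<open>\<phi> \<in> test_functions UNIV\<close>
  have sV: "smooth Y" if "Y \<in> V k" "k \<in> {1..s}" for Y k
    using stratification_layer(2)[OF S that(2)] that(1) smooth_left_invariant by blast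
  have j: "1 \<le> j" "j < s" and i: "Suc j < i" "i \<le> s"
    using step by auto
  have "V (j + 1) = bracket_span (V 1) (V j)"
    using S j by (auto simp: stratification_def)
  then have Y: "Y \<in> span {lie_bracket Z Y' | Z Y'. Z \<in> V 1 \<and> Y' \<in> V j}"
    using step by (simp add: bracket_span_def)
  show ?case
  proof (rule intertwining_span[OF lin _ _ _ Y \<phi>])
    show "i \<in> {1..s}" using i by simp
    show "smooth (B (i - Suc j) \<psi>)" if "\<psi> \<in> test_functions UNIV" for \<psi>
      using that i by (intro smooth) auto
    show "smooth U" if "U \<in> {lie_bracket Z Y' | Z Y'. Z \<in> V 1 \<and> Y' \<in> V j}" for U
      using that j sV by (auto intro!: smooth_lie_bracket)
    fix U and \<psi> :: "real ^ 'n \<Rightarrow> real"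
    assume U: "U \<in> {lie_bracket Z Y' | Z Y'. Z \<in> V 1 \<and> Y' \<in> V j}"
      and \<psi>: "\<psi> \<in> test_functions UNIV"
    obtain Z Y' where ZY: "U = lie_bracket Z Y'" "Z \<in> V 1" "Y' \<in> V j" using U by blast
    have sZ: "smooth Z" and sY: "smooth Y'" using sV ZY j by auto
    note t = vf_apply_test_function[OF sZ] vf_apply_test_function[OF sY]
    have ij: "i - j \<in> {2..s}" using i by auto
    have sB: "smooth (B (i - Suc j) \<psi>)" using i \<psi> by (intro smooth) auto
    have U_eq: "vf_apply U \<psi> = (\<lambda>p. (- 1) * vf_apply Y' (vf_apply Z \<psi>) p + vf_apply Z (vf_apply Y' \<psi>) p)"
      using vf_apply_lie_bracket[OF test_function_smooth[OF \<psi>] sZ sY] ZY by simp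
    have "test_linear (B i)" using lin i by simp
    then have "B i (vf_apply U \<psi>) =
        (- 1) *\<^sub>R B i (vf_apply Y' (vf_apply Z \<psi>)) + B i (vf_apply Z (vf_apply Y' \<psi>))"
      unfolding U_eq test_linear_def using t \<psi> by blast
    also have "B i (vf_apply Y' (vf_apply Z \<psi>)) = lie_bracket Y' (B (i - j) (vf_apply Z \<psi>))"
      using step.IH i ZY t \<psi> by simp
    also have "B (i - j) (vf_apply Z \<psi>) = lie_bracket Z (B (i - Suc j) \<psi>)"
      using assms(4)[OF ij ZY(2) \<psi>] by simp
    also have "B i (vf_apply Z (vf_apply Y' \<psi>)) = lie_bracket Z (B (i - 1) (vf_apply Y' \<psi>))"
      using assms(4) i ZY t \<psi> by simp
    also have "B (i - 1) (vf_apply Y' \<psi>) = lie_bracket Y' (B (i - Suc j) \<psi>)"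
      using step.IH[of "i - 1" Y' \<psi>] i ZY \<psi> by simp
    finally show "B i (vf_apply U \<psi>) = lie_bracket U (B (i - Suc j) \<psi>)"
      unfolding ZY(1) lie_bracket_Jacobi[OF sZ sY sB]
      by (simp only: scaleR_minus1_left uminus_add_conv_diff)
  qed
qed

section \<open>Weak derivatives of the components\<close>

text \<open>The minus sign comes from the order of the arguments: \<open>c (i - j) j\<close> expands the bracket in which
  the field of layer \<open>i - j\<close> stands first.  It cancels the sign in the definition of the distributional
  derivative.\<close>

lemma bracket_components:
  assumes C: "structural_constants s n X c"
    and sm: "\<And>i \<gamma>. i \<in> {1..s} \<Longrightarrow> \<gamma> \<in> {1..n i} \<Longrightarrow> smooth (X i \<gamma>)"
    and ij: "1 \<le> j" "j < i" "i \<le> s" and a: "a \<in> {1..n j}"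
  shows "lie_bracket (X j a) (\<Sum>\<beta>=1..n (i - j). t \<beta> *\<^sub>R X (i - j) \<beta>) =
    (\<Sum>\<gamma>=1..n i. (- (\<Sum>\<beta>=1..n (i - j). c (i - j) j \<gamma> \<beta> a * t \<beta>)) *\<^sub>R X i \<gamma>)"
proof -
  have "lie_bracket (X j a) (\<Sum>\<beta>=1..n (i - j). t \<beta> *\<^sub>R X (i - j) \<beta>) =
      (\<Sum>\<beta>=1..n (i - j). t \<beta> *\<^sub>R lie_bracket (X j a) (X (i - j) \<beta>))"
    using ij a by (intro lie_bracket_sum_right sm) auto
  also have "\<dots> = (\<Sum>\<beta>=1..n (i - j). t \<beta> *\<^sub>R - (\<Sum>\<gamma>=1..n i. c (i - j) j \<gamma> \<beta> a *\<^sub>R X i \<gamma>))"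
  proof (rule sum.cong[OF refl])
    fix \<beta> assume \<beta>: "\<beta> \<in> {1..n (i - j)}"
    have "1 \<le> i - j" "i - j + j \<le> s" and e: "i - j + j = i" using ij by auto
    then have "lie_bracket (X (i - j) \<beta>) (X j a) =
        (\<Sum>\<gamma>=1..n (i - j + j). c (i - j) j \<gamma> \<beta> a *\<^sub>R X (i - j + j) \<gamma>)"
      using C ij(1) \<beta> a unfolding structural_constants_def by blast
    then show "t \<beta> *\<^sub>R lie_bracket (X j a) (X (i - j) \<beta>) =
        t \<beta> *\<^sub>R - (\<Sum>\<gamma>=1..n i. c (i - j) j \<gamma> \<beta> a *\<^sub>R X i \<gamma>)"
      unfolding lie_bracket_antisym[of "X j a"] e by (rule arg_cong)
  qed
  also have "\<dots> = (\<Sum>\<gamma>=1..n i. (- (\<Sum>\<beta>=1..n (i - j). c (i - j) j \<gamma> \<beta> a * t \<beta>)) *\<^sub>R X i \<gamma>)"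
  proof
    fix p
    have "(\<Sum>\<beta>=1..n (i - j). t \<beta> *\<^sub>R - (\<Sum>\<gamma>=1..n i. c (i - j) j \<gamma> \<beta> a *\<^sub>R X i \<gamma> p)) =
       (\<Sum>\<beta>=1..n (i - j). \<Sum>\<gamma>=1..n i. - ((c (i - j) j \<gamma> \<beta> a * t \<beta>) *\<^sub>R X i \<gamma> p))"
      by (simp add: scaleR_sum_right sum_negf mult.commute)
    also have "\<dots> = (\<Sum>\<gamma>=1..n i. (- (\<Sum>\<beta>=1..n (i - j). c (i - j) j \<gamma> \<beta> a * t \<beta>)) *\<^sub>R X i \<gamma> p)"
      by (subst sum.swap) (simp add: scaleR_sum_left sum_negf)
    finally show "(\<Sum>\<beta>=1..n (i - j). t \<beta> *\<^sub>R - (\<Sum>\<gamma>=1..n i. c (i - j) j \<gamma> \<beta> a *\<^sub>R X i \<gamma>)) p =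
        (\<Sum>\<gamma>=1..n i. (- (\<Sum>\<beta>=1..n (i - j). c (i - j) j \<gamma> \<beta> a * t \<beta>)) *\<^sub>R X i \<gamma>) p"
      by (simp add: sum_fields_apply scaleR_fun_def)
  qed
  finally show ?thesis .
qed

lemma foldr_distribution_deriv_sum:
  assumes "\<And>\<phi>. \<phi> \<in> test_functions UNIV \<Longrightarrow> S \<phi> = (\<Sum>x\<in>A. a x * T x \<phi>)"
  shows "(\<And>X. X \<in> set Xs \<Longrightarrow> smooth X) \<Longrightarrow> \<phi> \<in> test_functions UNIV \<Longrightarrow>
    foldr distribution_deriv Xs S \<phi> = (\<Sum>x\<in>A. a x * foldr distribution_deriv Xs (T x) \<phi>)"
proof (induction Xs arbitrary: \<phi>)
  case Nil
  then show ?case using assms by simp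
next
  case (Cons X Xs)
  then show ?case
    by (simp add: distribution_deriv_def vf_apply_test_function sum_negf)
qed

lemma sum_PiE_insert:
  assumes "x \<notin> A"
  shows "(\<Sum>g\<in>PiE (insert x A) F. f g) = (\<Sum>y\<in>F x. \<Sum>g\<in>PiE A F. f (g(x := y)))"
proof -
  have "(\<Sum>g\<in>PiE (insert x A) F. f g) = (\<Sum>z\<in>F x \<times> PiE A F. f ((\<lambda>(y, g). g(x := y)) z))"
    unfolding PiE_insert_eq using sum.reindex[OF inj_combinator[OF assms, of F]] by (simp add: o_def)
  then show ?thesis by (simp add: sum.cartesian_product case_prod_unfold)
qed

text \<open>The last operator acts first.  It lowers the layer from \<open>i\<close> to \<open>i - \<iota> k\<close> and creates the sum over
  \<open>\<beta>\<^sub>k\<^sub>-\<^sub>1\<close>, which then is the fixed last index for the remaining \<open>k - 1\<close> operators; so \<open>i\<close> and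
  \<open>\<beta>\<^sub>k\<close> vary in the induction.\<close>

lemma iterated_derivative_expansion:
  fixes X :: "nat \<Rightarrow> nat \<Rightarrow> ('n::finite) vfield"
  assumes sm: "\<And>i \<gamma>. i \<in> {1..s} \<Longrightarrow> \<gamma> \<in> {1..n i} \<Longrightarrow> smooth (X i \<gamma>)"
    and one: "\<And>i j \<gamma> a \<phi>. 1 \<le> j \<Longrightarrow> j < i \<Longrightarrow> i \<le> s \<Longrightarrow> \<gamma> \<in> {1..n i} \<Longrightarrow> a \<in> {1..n j} \<Longrightarrow>
      \<phi> \<in> test_functions UNIV \<Longrightarrow>
      distribution_deriv (X j a) (T i \<gamma>) \<phi> = (\<Sum>\<beta>=1..n (i - j). c (i - j) j \<gamma> \<beta> a * T (i - j) \<beta> \<phi>)"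
  shows "1 \<le> k \<Longrightarrow> \<forall>j\<in>{1..k}. \<iota> j \<in> {1..s} \<Longrightarrow> \<forall>j\<in>{1..k}. \<alpha> j \<in> {1..n (\<iota> j)} \<Longrightarrow>
    (\<Sum>j=1..k. \<iota> j) < i \<Longrightarrow> i \<le> s \<Longrightarrow> \<beta>\<^sub>k \<in> {1..n i} \<Longrightarrow> \<phi> \<in> test_functions UNIV \<Longrightarrow>
    foldr distribution_deriv (map (\<lambda>j. X (\<iota> j) (\<alpha> j)) [1..<k + 1]) (T i \<beta>\<^sub>k) \<phi> =
    (\<Sum>\<beta>\<in>(\<Pi>\<^sub>E j\<in>{1..k - 1}. {1..n (i - (\<Sum>j=1..k. \<iota> j) + (\<Sum>l=1..j. \<iota> l))}).
      \<Sum>\<beta>\<^sub>0=1..n (i - (\<Sum>j=1..k. \<iota> j)).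
       (\<Prod>j=1..k. c (i - (\<Sum>l=j..k. \<iota> l)) (\<iota> j)
                    ((\<beta>(0 := \<beta>\<^sub>0, k := \<beta>\<^sub>k)) j) ((\<beta>(0 := \<beta>\<^sub>0, k := \<beta>\<^sub>k)) (j - 1)) (\<alpha> j))
       * T (i - (\<Sum>j=1..k. \<iota> j)) \<beta>\<^sub>0 \<phi>)"
proof (induction k arbitrary: i \<beta>\<^sub>k \<phi> rule: dec_induct)
  case base
  then show ?case using one[of "\<iota> 1" i \<beta>\<^sub>k "\<alpha> 1" \<phi>] by simp
next
  case (step k)
  let ?Xs = "map (\<lambda>j. X (\<iota> j) (\<alpha> j)) [1..<k + 1]" and ?j = "\<iota> (Suc k)"
  let ?m = "\<Sum>j=1..k. \<iota> j"
  let ?i' = "i - ?j"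
  have j: "1 \<le> ?j" "\<alpha> (Suc k) \<in> {1..n ?j}" using step.prems by auto
  have m: "(\<Sum>j=1..Suc k. \<iota> j) = ?m + ?j" by simp
  have i': "?m < ?i'" "?i' \<le> s" "?j < i"
    using step.prems unfolding m by auto
  have sub: "i - (?m + ?j) = ?i' - ?m" by simp
  let ?N = "\<lambda>j. {1..n (?i' - ?m + (\<Sum>l=1..j. \<iota> l))}"
  have N: "?N k = {1..n ?i'}" using i' by simp
  let ?P = "\<lambda>\<gamma> \<beta> \<beta>\<^sub>0. \<Prod>j=1..k. c (?i' - (\<Sum>l=j..k. \<iota> l)) (\<iota> j)
    ((\<beta>(0 := \<beta>\<^sub>0, k := \<gamma>)) j) ((\<beta>(0 := \<beta>\<^sub>0, k := \<gamma>)) (j - 1)) (\<alpha> j)"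
  have smXs: "smooth Y" if "Y \<in> set ?Xs" for Y
    using that step.prems by (auto intro!: sm)
  have prod: "(\<Prod>j=1..Suc k. c (i - (\<Sum>l=j..Suc k. \<iota> l)) (\<iota> j)
       (((\<beta>(k := \<gamma>))(0 := \<beta>\<^sub>0, Suc k := \<beta>\<^sub>k)) j)
       (((\<beta>(k := \<gamma>))(0 := \<beta>\<^sub>0, Suc k := \<beta>\<^sub>k)) (j - 1)) (\<alpha> j)) =
       c ?i' ?j \<beta>\<^sub>k \<gamma> (\<alpha> (Suc k)) * ?P \<gamma> \<beta> \<beta>\<^sub>0" for \<gamma> \<beta> \<beta>\<^sub>0
  proof -
    have "(\<Prod>j=1..k. c (i - (\<Sum>l=j..Suc k. \<iota> l)) (\<iota> j)
       (((\<beta>(k := \<gamma>))(0 := \<beta>\<^sub>0, Suc k := \<beta>\<^sub>k)) j)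
       (((\<beta>(k := \<gamma>))(0 := \<beta>\<^sub>0, Suc k := \<beta>\<^sub>k)) (j - 1)) (\<alpha> j)) = ?P \<gamma> \<beta> \<beta>\<^sub>0"
    proof (rule prod.cong[OF refl])
      fix j assume "j \<in> {1..k}"
      moreover from this have "i - (\<Sum>l=j..Suc k. \<iota> l) = ?i' - (\<Sum>l=j..k. \<iota> l)" by simp
      ultimately show "c (i - (\<Sum>l=j..Suc k. \<iota> l)) (\<iota> j)
         (((\<beta>(k := \<gamma>))(0 := \<beta>\<^sub>0, Suc k := \<beta>\<^sub>k)) j)
         (((\<beta>(k := \<gamma>))(0 := \<beta>\<^sub>0, Suc k := \<beta>\<^sub>k)) (j - 1)) (\<alpha> j) =
         c (?i' - (\<Sum>l=j..k. \<iota> l)) (\<iota> j)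
         ((\<beta>(0 := \<beta>\<^sub>0, k := \<gamma>)) j) ((\<beta>(0 := \<beta>\<^sub>0, k := \<gamma>)) (j - 1)) (\<alpha> j)"
        by auto
    qed
    then show ?thesis using step.hyps by simp
  qed
  have "foldr distribution_deriv (map (\<lambda>j. X (\<iota> j) (\<alpha> j)) [1..<Suc k + 1]) (T i \<beta>\<^sub>k) \<phi> =
      foldr distribution_deriv ?Xs (distribution_deriv (X ?j (\<alpha> (Suc k))) (T i \<beta>\<^sub>k)) \<phi>"
    by simp
  also have "\<dots> = (\<Sum>\<gamma>=1..n ?i'. c ?i' ?j \<beta>\<^sub>k \<gamma> (\<alpha> (Suc k)) *
      foldr distribution_deriv ?Xs (T ?i' \<gamma>) \<phi>)"
    using step.prems by (intro foldr_distribution_deriv_sum one smXs j i')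
  also have "\<dots> = (\<Sum>\<gamma>=1..n ?i'. c ?i' ?j \<beta>\<^sub>k \<gamma> (\<alpha> (Suc k)) *
      (\<Sum>\<beta>\<in>PiE {1..k - 1} ?N. \<Sum>\<beta>\<^sub>0=1..n (?i' - ?m). ?P \<gamma> \<beta> \<beta>\<^sub>0 * T (?i' - ?m) \<beta>\<^sub>0 \<phi>))"
    using step.prems i' by (intro sum.cong refl arg_cong2[where f = "(*)"] step.IH) auto
  also have "\<dots> = (\<Sum>\<gamma>\<in>?N k. \<Sum>\<beta>\<in>PiE {1..k - 1} ?N. \<Sum>\<beta>\<^sub>0=1..n (?i' - ?m).
      (c ?i' ?j \<beta>\<^sub>k \<gamma> (\<alpha> (Suc k)) * ?P \<gamma> \<beta> \<beta>\<^sub>0) * T (?i' - ?m) \<beta>\<^sub>0 \<phi>)"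
    unfolding N sum_distrib_left mult.assoc ..
  also have "\<dots> = (\<Sum>\<beta>\<in>PiE (insert k {1..k - 1}) ?N. \<Sum>\<beta>\<^sub>0=1..n (?i' - ?m).
      (\<Prod>j=1..Suc k. c (i - (\<Sum>l=j..Suc k. \<iota> l)) (\<iota> j)
       ((\<beta>(0 := \<beta>\<^sub>0, Suc k := \<beta>\<^sub>k)) j) ((\<beta>(0 := \<beta>\<^sub>0, Suc k := \<beta>\<^sub>k)) (j - 1)) (\<alpha> j))
      * T (?i' - ?m) \<beta>\<^sub>0 \<phi>)"
    using step.hyps by (subst sum_PiE_insert) (auto simp only: prod atLeastAtMost_iff)
  also have "insert k {1..k - 1} = {1..Suc k - 1}"
    using step.hyps by auto
  finally show ?case unfolding m sub .
qed

text \<open>The fields \<open>F i \<phi>\<close> carry the argument: the hypothesis on \<open>[b, V 1]\<close> is the intertwining relation for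
  the basis of \<open>V 1\<close>, hence the relation holds for all layers, and its coefficients in the basis of
  \<open>V i\<close> are the claim.\<close>

lemma one_step_derivative:
  fixes mul :: "real ^ 'n::finite \<Rightarrow> real ^ 'n \<Rightarrow> real ^ 'n"
  assumes G: "lie_group mul e iv"
    and S: "stratification (left_invariant_fields mul) s V"
    and B: "graded_basis s V n X" and C: "structural_constants s n X c"
    and b: "\<forall>i\<in>{1..s}. \<forall>\<alpha>\<in>{1..n i}. b i \<alpha> \<in> horizontal_sobolev_loc \<theta> UNIV n X"
    and H: "\<forall>Z\<in>V 1. AE p in lebesgue. weak_commutator s n X b Z p \<in> horizontal_distribution V p"
    and loc: "\<And>i \<gamma>. i \<in> {1..s} \<Longrightarrow> \<gamma> \<in> {1..n i} \<Longrightarrow> in_Lp_loc 1 UNIV (b i \<gamma>)"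
    and ij: "1 \<le> j" "j < i" "i \<le> s" and \<gamma>: "\<gamma> \<in> {1..n i}" and a: "a \<in> {1..n j}"
    and \<phi>: "\<phi> \<in> test_functions UNIV"
  shows "distribution_deriv (X j a) (regular_distribution UNIV (b i \<gamma>)) \<phi> =
    (\<Sum>\<beta>=1..n (i - j). c (i - j) j \<gamma> \<beta> a * regular_distribution UNIV (b (i - j) \<beta>) \<phi>)"
proof -
  have sm: "smooth (X i \<gamma>)" if "i \<in> {1..s}" "\<gamma> \<in> {1..n i}" for i \<gamma>
    using graded_basis_in_layer[OF B that] stratification_layer(2)[OF S that(1)]
      smooth_left_invariant by blast
  have s: "1 \<in> {1..s}" using S by (auto simp: stratification_def)
  define T where "T = (\<lambda>i \<gamma>. regular_distribution UNIV (b i \<gamma>))"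
  define F where "F = (\<lambda>i \<phi>. \<Sum>\<gamma>=1..n i. T i \<gamma> \<phi> *\<^sub>R X i \<gamma>)"
  have F_smooth: "smooth (F i \<phi>)" if "i \<in> {1..s}" for i \<phi>
    unfolding F_def by (intro smooth_field_sum smooth_field_scaleR sm that)
  have F_linear: "test_linear (F i)" if "i \<in> {1..s}" for i
    unfolding test_linear_def
  proof (intro ballI allI)
    fix \<phi> \<psi> :: "real ^ 'n \<Rightarrow> real" and r
    assume t: "\<phi> \<in> test_functions UNIV" "\<psi> \<in> test_functions UNIV"
    have "F i (\<lambda>p. r * \<phi> p + \<psi> p) = (\<Sum>\<gamma>=1..n i. (r * T i \<gamma> \<phi> + T i \<gamma> \<psi>) *\<^sub>R X i \<gamma>)"
      unfolding F_def T_def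
      by (intro sum.cong refl arg_cong2[where f = scaleR] regular_distribution_linear_test loc that t)
    then show "F i (\<lambda>p. r * \<phi> p + \<psi> p) = r *\<^sub>R F i \<phi> + F i \<psi>"
      unfolding F_def scaleR_sum_right scaleR_add_left sum.distrib scaleR_scaleR .
  qed
  have bracket: "lie_bracket (X j a) (F (i - j) \<phi>) =
      (\<Sum>\<gamma>=1..n i. (- (\<Sum>\<beta>=1..n (i - j). c (i - j) j \<gamma> \<beta> a * T (i - j) \<beta> \<phi>)) *\<^sub>R X i \<gamma>)"
    if "1 \<le> j" "j < i" "i \<le> s" "a \<in> {1..n j}" for i j a \<phi>
    unfolding F_def by (rule bracket_components[OF C _ that]) (rule sm)
  have first: "T i \<gamma> (vf_apply (X 1 a) \<phi>) = - (\<Sum>\<beta>=1..n (i - 1). c (i - 1) 1 \<gamma> \<beta> a * T (i - 1) \<beta> \<phi>)"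
    if i: "i \<in> {2..s}" and \<gamma>: "\<gamma> \<in> {1..n i}" and a: "a \<in> {1..n 1}" and \<phi>: "\<phi> \<in> test_functions UNIV"
    for i \<gamma> a \<phi>
  proof -
    let ?w = "weak_deriv (X 1 a) (b i \<gamma>)"
    let ?u = "\<lambda>p. \<Sum>\<beta>=1..n (i - 1). c (i - 1) 1 \<gamma> \<beta> a * b (i - 1) \<beta> p"
    have "b i \<gamma> \<in> horizontal_sobolev_loc \<theta> UNIV n X" using b i \<gamma> by simp
    then have "\<exists>w. weak_derivative UNIV [X 1 a] (b i \<gamma>) w"
      using a by (auto simp: horizontal_sobolev_loc_def)
    then have w: "weak_derivative UNIV [X 1 a] (b i \<gamma>) ?w"
      unfolding weak_deriv_def by (rule someI_ex)
    have "AE p in lebesgue. weak_commutator s n X b (X 1 a) p \<in> horizontal_distribution V p"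
      using H graded_basis_in_layer[OF B s a] by blast
    then have ae: "AE p in lebesgue. ?w p = ?u p"
      by eventually_elim (rule horizontal_condition_components[OF G S B C a i \<gamma>])
    have lb: "in_Lp_loc 1 UNIV (b (i - 1) \<beta>)" if "\<beta> \<in> {1..n (i - 1)}" for \<beta>
      using i that by (intro loc) auto
    have "- T i \<gamma> (vf_apply (X 1 a) \<phi>) = regular_distribution UNIV ?w \<phi>"
      using w \<phi> by (simp add: weak_derivative_def distribution_deriv_def T_def)
    also have "\<dots> = regular_distribution UNIV ?u \<phi>"
      using w by (intro regular_distribution_cong_AE[OF _ _ \<phi> ae] in_Lp_loc_one_sum lb)
        (auto simp: weak_derivative_def)
    also have "\<dots> = (\<Sum>\<beta>=1..n (i - 1). c (i - 1) 1 \<gamma> \<beta> a * T (i - 1) \<beta> \<phi>)"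
      unfolding T_def by (intro regular_distribution_sum lb \<phi>)
    finally show ?thesis by simp
  qed
  have V1: "V 1 = span (X 1 ` {1..n 1})"
    using B s unfolding graded_basis_def by blast
  have base: "F i (vf_apply Y \<phi>) = lie_bracket Y (F (i - 1) \<phi>)"
    if i: "i \<in> {2..s}" and Y: "Y \<in> V 1" and \<phi>: "\<phi> \<in> test_functions UNIV" for i Y \<phi>
  proof (rule intertwining_span[OF F_linear _ _ _ _ \<phi>])
    show "i \<in> {1..s}" using i by simp
    show "smooth (F (i - 1) \<psi>)" for \<psi> using i by (intro F_smooth) auto
    show "Y \<in> span (X 1 ` {1..n 1})" using Y V1 by simp
    show "smooth U" if "U \<in> X 1 ` {1..n 1}" for U using that s by (auto intro: sm)
    fix U and \<psi> :: "real ^ 'n \<Rightarrow> real"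
    assume "U \<in> X 1 ` {1..n 1}" and \<psi>: "\<psi> \<in> test_functions UNIV"
    then obtain a where a: "a \<in> {1..n 1}" "U = X 1 a" by blast
    have i1: "1 < i" "i \<le> s" using i by auto
    show "F i (vf_apply U \<psi>) = lie_bracket U (F (i - 1) \<psi>)"
      unfolding a(2) bracket[OF order_refl i1 a(1)] unfolding F_def
      by (intro sum.cong refl arg_cong2[where f = scaleR] first i a \<psi>)
  qed
  have Xj: "X j a \<in> V j" using graded_basis_in_layer[OF B _ a] ij by simp
  have "F i (vf_apply (X j a) \<phi>) = lie_bracket (X j a) (F (i - j) \<phi>)"
    by (rule intertwining_all_layers[OF S, where B = F]; (rule F_linear F_smooth base ij Xj \<phi>; assumption?))
  then have "(\<Sum>\<gamma>=1..n i. T i \<gamma> (vf_apply (X j a) \<phi>) *\<^sub>R X i \<gamma>) =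
      (\<Sum>\<gamma>=1..n i. (- (\<Sum>\<beta>=1..n (i - j). c (i - j) j \<gamma> \<beta> a * T (i - j) \<beta> \<phi>)) *\<^sub>R X i \<gamma>)"
    unfolding bracket[OF ij a] unfolding F_def .
  from graded_basis_coefficients[OF B _ this \<gamma>] ij
  have "T i \<gamma> (vf_apply (X j a) \<phi>) = - (\<Sum>\<beta>=1..n (i - j). c (i - j) j \<gamma> \<beta> a * T (i - j) \<beta> \<phi>)"
    by simp
  then show ?thesis by (simp add: T_def distribution_deriv_def)
qed

theorem proposition4p3:
  fixes mul :: "real ^ 'n::finite \<Rightarrow> real ^ 'n \<Rightarrow> real ^ 'n"
    and e :: "real ^ 'n"
    and iv :: "real ^ 'n \<Rightarrow> real ^ 'n"
    and s :: nat
    and V :: "nat \<Rightarrow> 'n vfield set"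
    and n :: "nat \<Rightarrow> nat"
    and X :: "nat \<Rightarrow> nat \<Rightarrow> 'n vfield"
    and coord :: "nat \<Rightarrow> nat \<Rightarrow> 'n"
    and c :: "nat \<Rightarrow> nat \<Rightarrow> nat \<Rightarrow> nat \<Rightarrow> nat \<Rightarrow> real"
    and \<theta> :: ennreal
    and b :: "nat \<Rightarrow> nat \<Rightarrow> real ^ 'n \<Rightarrow> real"
    and k i m \<beta>\<^sub>k :: nat
    and \<iota> \<alpha> :: "nat \<Rightarrow> nat"
  assumes "lie_group mul e iv"
    and "stratification (left_invariant_fields mul) s V"
    and "graded_basis s V n X"
    and "graded_exponential_coordinates e s n X coord"
    and "structural_constants s n X c"
    and "1 \<le> \<theta>"
    and "\<forall>i\<in>{1..s}. \<forall>\<alpha>\<in>{1..n i}. b i \<alpha> \<in> horizontal_sobolev_loc \<theta> UNIV n X"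
    and "\<forall>Z\<in>V 1. AE p in lebesgue. weak_commutator s n X b Z p \<in> horizontal_distribution V p"
    and "1 \<le> k"
    and "i \<in> {2..s}"
    and "\<forall>j\<in>{1..k}. \<iota> j \<in> {1..s}"
    and "m = (\<Sum>j=1..k. \<iota> j)"
    and "m < i"
    and "\<forall>j\<in>{1..k}. \<alpha> j \<in> {1..n (\<iota> j)}"
    and "\<beta>\<^sub>k \<in> {1..n i}"
  shows "weak_derivative UNIV (map (\<lambda>j. X (\<iota> j) (\<alpha> j)) [1..<k + 1]) (b i \<beta>\<^sub>k)
    (\<lambda>p. \<Sum>\<beta>\<in>(\<Pi>\<^sub>E j\<in>{1..k - 1}. {1..n (i - m + (\<Sum>l=1..j. \<iota> l))}). \<Sum>\<beta>\<^sub>0=1..n (i - m).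
       (\<Prod>j=1..k. c (i - (\<Sum>l=j..k. \<iota> l)) (\<iota> j)
                    ((\<beta>(0 := \<beta>\<^sub>0, k := \<beta>\<^sub>k)) j) ((\<beta>(0 := \<beta>\<^sub>0, k := \<beta>\<^sub>k)) (j - 1)) (\<alpha> j))
       * b (i - m) \<beta>\<^sub>0 p)"
proof -
  let ?I = "\<Pi>\<^sub>E j\<in>{1..k - 1}. {1..n (i - m + (\<Sum>l=1..j. \<iota> l))}"
  let ?c = "\<lambda>\<beta> \<beta>\<^sub>0. \<Prod>j=1..k. c (i - (\<Sum>l=j..k. \<iota> l)) (\<iota> j)
    ((\<beta>(0 := \<beta>\<^sub>0, k := \<beta>\<^sub>k)) j) ((\<beta>(0 := \<beta>\<^sub>0, k := \<beta>\<^sub>k)) (j - 1)) (\<alpha> j)"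
  let ?u = "\<lambda>\<beta> p. \<Sum>\<beta>\<^sub>0=1..n (i - m). ?c \<beta> \<beta>\<^sub>0 * b (i - m) \<beta>\<^sub>0 p"
  have s: "1 \<in> {1..s}" and V1: "V 1 \<noteq> {0}"
    using assms(2) by (auto simp: stratification_def)
  have "span (X 1 ` {1..n 1}) = V 1"
    using assms(3) s unfolding graded_basis_def by blast
  \<comment> \<open>Local integrability of \<open>b i \<gamma>\<close> is part of the existence of some first horizontal weak derivative,
    so one horizontal direction is needed.\<close>
  with V1 have n1: "1 \<in> {1..n 1}" by (cases "n 1 = 0") auto
  have loc: "in_Lp_loc 1 UNIV (b i \<gamma>)" if "i \<in> {1..s}" "\<gamma> \<in> {1..n i}" for i \<gamma>
    using assms(7) that n1 by (fastforce simp: horizontal_sobolev_loc_def weak_derivative_def)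
  have sm: "smooth (X i \<gamma>)" if "i \<in> {1..s}" "\<gamma> \<in> {1..n i}" for i \<gamma>
    using graded_basis_in_layer[OF assms(3) that] stratification_layer(2)[OF assms(2) that(1)]
      smooth_left_invariant by blast
  have i: "i \<le> s" "i \<in> {1..s}" and im: "i - m \<in> {1..s}"
    using assms(10,13) by auto
  have locu: "in_Lp_loc 1 UNIV (?u \<beta>)" for \<beta>
    by (intro in_Lp_loc_one_sum loc im)
  have locw: "in_Lp_loc 1 UNIV (\<lambda>p. \<Sum>\<beta>\<in>?I. ?u \<beta> p)"
    using in_Lp_loc_one_sum[of ?I ?u "\<lambda>_. 1", OF locu] by simp
  have "foldr distribution_deriv (map (\<lambda>j. X (\<iota> j) (\<alpha> j)) [1..<k + 1])
      (regular_distribution UNIV (b i \<beta>\<^sub>k)) \<phi> = regular_distribution UNIV (\<lambda>p. \<Sum>\<beta>\<in>?I. ?u \<beta> p) \<phi>"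
    if \<phi>: "\<phi> \<in> test_functions UNIV" for \<phi>
  proof -
    have "regular_distribution UNIV (\<lambda>p. \<Sum>\<beta>\<in>?I. ?u \<beta> p) \<phi> =
        (\<Sum>\<beta>\<in>?I. regular_distribution UNIV (?u \<beta>) \<phi>)"
      using regular_distribution_sum[of ?I ?u \<phi> "\<lambda>_. 1", OF locu \<phi>] by simp
    also have "\<dots> = (\<Sum>\<beta>\<in>?I. \<Sum>\<beta>\<^sub>0=1..n (i - m). ?c \<beta> \<beta>\<^sub>0 * regular_distribution UNIV (b (i - m) \<beta>\<^sub>0) \<phi>)"
      by (intro sum.cong refl regular_distribution_sum loc im \<phi>)
    also have "\<dots> = foldr distribution_deriv (map (\<lambda>j. X (\<iota> j) (\<alpha> j)) [1..<k + 1])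
      (regular_distribution UNIV (b i \<beta>\<^sub>k)) \<phi>"
      unfolding assms(12)
      by (rule iterated_derivative_expansion[symmetric,
            where T = "\<lambda>i \<gamma>. regular_distribution UNIV (b i \<gamma>)" and s = s,
            OF sm one_step_derivative[OF assms(1-3,5,7,8) loc]])
         (use assms(9,11-15) i \<phi> in auto)
    finally show ?thesis ..
  qed
  then show ?thesis
    unfolding weak_derivative_def using loc[OF i(2) assms(15)] locw by blast
qed

end
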